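(* Let $B > 0$, let $\omega_0,\omega_1 \in \mathbb{R}$ be such that $\omega_0 < \omega_1$, and let $f,g \in \mathrm{PW}_B^2$. Then $f \sim g$ if and only if $|\mathcal{G} f(x,\omega)| = |\mathcal{G} g(x,\omega)|$ for all $(x,\omega) \in \tfrac{1}{4B}\mathbb{Z} \times \{\omega_0,\omega_1\}$.
   Context: The Fourier transform convention is $\mathcal{F} f(\xi) = \int_{\mathbb{R}} f(t) \mathrm{e}^{-2\pi \mathrm{i} t \xi}\,\mathrm{d}t$ for $f\in L^1(\mathbb{R})$, extended to $L^2(\mathbb{R})$ as usual. For $B>0$, the Paley--Wiener space is $\mathrm{PW}_B^2 := \{ f \in L^2(\mathbb{R}) : \operatorname{supp}(\mathcal{F} f) \subset [-B,B] \}$, where functions are complex-valued and $\operatorname{supp} h \subset [a,b]$ means $h(t)=0$ for a.e. $t \notin [a,b]$. The Gabor transform of $f \in L^2(\mathbb{R})$ is $$\mathcal{G} f(x,\omega) := \sqrt[4]{2} \int_{\mathbb{R}} f(t)\, \mathrm{e}^{-\pi (t-x)^2} \mathrm{e}^{-2\pi \mathrm{i} t \omega} \,\mathrm{d}t, \qquad (x,\omega) \in \mathbb{R}^2.$$ For complex-valued functions, $f \sim g$ (agreement up to global phase) means that there exists $\alpha \in \mathbb{R}$ with $f = \mathrm{e}^{\mathrm{i}\alpha} g$ (equality in $L^2(\mathbb{R})$, i.e. almost everywhere, for elements of $L^2(\mathbb{R})$). *)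

theory Defs
  imports "HOL-Analysis.Analysis"
begin

text \<open>
  Elements of $L^2(\mathbb{R})$ are represented by Borel measurable functions; equality in
  $L^2(\mathbb{R})$ is equality almost everywhere.
\<close>

definition L2 :: "(real \<Rightarrow> complex) set" where
  "L2 = {f \<in> borel_measurable lborel. integrable lborel (\<lambda>t. (cmod (f t))\<^sup>2)}"

definition L1 :: "(real \<Rightarrow> complex) set" where
  "L1 = {f. integrable lborel f}"

definition tendsto_L2 :: "(nat \<Rightarrow> real \<Rightarrow> complex) \<Rightarrow> (real \<Rightarrow> complex) \<Rightarrow> bool" where
  "tendsto_L2 \<phi> f \<longleftrightarrow>
     (\<lambda>n. \<integral>\<^sup>+ t. ennreal ((cmod (\<phi> n t - f t))\<^sup>2) \<partial>lborel) \<longlonglongrightarrow> 0"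

definition fourier_L1 :: "(real \<Rightarrow> complex) \<Rightarrow> real \<Rightarrow> complex" where
  "fourier_L1 f \<xi> =
     (LINT t|lborel. f t * exp (- 2 * complex_of_real pi * \<i> * of_real t * of_real \<xi>))"

text \<open>
  The extension of the Fourier transform to $L^2(\mathbb{R})$ by continuity from the dense
  subspace $L^1(\mathbb{R}) \cap L^2(\mathbb{R})$, written as a relation because its value
  is only determined almost everywhere. By Plancherel's theorem every \<open>f \<in> L2\<close> has such
  an \<open>h\<close>, it is unique up to null sets, and it does not depend on the
  approximating sequence.
\<close>

definition has_fourier_L2 :: "(real \<Rightarrow> complex) \<Rightarrow> (real \<Rightarrow> complex) \<Rightarrow> bool" where
  "has_fourier_L2 f h \<longleftrightarrow> f \<in> L2 \<and> h \<in> L2 \<and>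
     (\<exists>\<phi>. (\<forall>n. \<phi> n \<in> L1 \<inter> L2) \<and> tendsto_L2 \<phi> f \<and> tendsto_L2 (\<lambda>n. fourier_L1 (\<phi> n)) h)"

definition supp_within :: "(real \<Rightarrow> complex) \<Rightarrow> real set \<Rightarrow> bool" where
  "supp_within h S \<longleftrightarrow> (AE t in lborel. t \<notin> S \<longrightarrow> h t = 0)"

definition PW2 :: "real \<Rightarrow> (real \<Rightarrow> complex) set" where
  "PW2 B = {f \<in> L2. \<exists>h. has_fourier_L2 f h \<and> supp_within h {-B..B}}"

definition gabor :: "(real \<Rightarrow> complex) \<Rightarrow> real \<Rightarrow> real \<Rightarrow> complex" where
  "gabor f x \<omega> = complex_of_real (root 4 2) *
     (LINT t|lborel. f t * of_real (exp (- pi * (t - x)\<^sup>2))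
                         * exp (- 2 * complex_of_real pi * \<i> * of_real t * of_real \<omega>))"

definition global_phase_eq :: "(real \<Rightarrow> complex) \<Rightarrow> (real \<Rightarrow> complex) \<Rightarrow> bool" where
  "global_phase_eq f g \<longleftrightarrow>
     (\<exists>\<alpha>::real. AE t in lborel. f t = exp (\<i> * of_real \<alpha>) * g t)"

end

theory Submission
  imports Defs "HOL-Probability.Characteristic_Functions" "HOL-Complex_Analysis.Complex_Analysis"
begin

text \<open>
  Let \<open>u\<close>, \<open>v\<close> be the Fourier transforms of \<open>f\<close>, \<open>g\<close>, let
  \<open>k \<xi> = u \<xi> exp (- \<pi> \<xi>\<^sup>2)\<close> and \<open>m \<xi> = v \<xi> exp (- \<pi> \<xi>\<^sup>2)\<close>, and let
  \<open>P\<close>, \<open>Q\<close> be the entire functions \<open>z \<mapsto> \<integral> k \<xi> exp (2 \<pi> i z \<xi>) d\<xi>\<close> and the same for \<open>m\<close>.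
  Up to a unimodular factor and a constant depending only on \<open>\<omega>\<close>, the Gabor transform of \<open>f\<close> at
  \<open>(x, \<omega>)\<close> is \<open>P (x - i \<omega>)\<close>. On a horizontal line \<open>|P|\<^sup>2 - |Q|\<^sup>2\<close> is band-limited to
  \<open>[-2B, 2B]\<close>, so vanishing on the grid of mesh \<open>1 / (4B)\<close> makes it vanish on the line.
  Hence \<open>|P| = |Q|\<close> on two lines, and Schwarz reflection in both shows that \<open>P / Q\<close> is periodic
  with an imaginary period \<open>i s\<close>. So \<open>P (z + i n s) = c Q (z + i n s)\<close> for some \<open>z\<close>, some
  unimodular \<open>c\<close> and all \<open>n\<close>, which says that all moments of \<open>(k - c m) exp (2 \<pi> i z \<xi>)\<close>
  with respect to the variable \<open>exp (- 2 \<pi> s \<xi>)\<close> vanish; therefore \<open>k = c m\<close> almost everywhere.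
  The sampling step, the moment step and the injectivity of the Fourier transform all
  come from the Stone-Weierstrass theorem.
\<close>

subsection \<open>Vanishing moments\<close>

text \<open>The bound is asked only where \<open>F\<close> is nonzero; this admits factors such as
  exponentials, unbounded on the line, against a compactly supported \<open>F\<close>.\<close>

lemma integrable_mult_bounded:
  fixes F b :: "'a \<Rightarrow> complex"
  assumes "integrable M F" "b \<in> borel_measurable M" "\<And>t. F t \<noteq> 0 \<Longrightarrow> cmod (b t) \<le> C"
  shows "integrable M (\<lambda>t. F t * b t)"
proof (rule Bochner_Integration.integrable_bound)
  show "integrable M (\<lambda>t. C *\<^sub>R F t)" using assms(1) by simp
  show "(\<lambda>t. F t * b t) \<in> borel_measurable M" using assms(1,2) by simp
  have "cmod (F t) * cmod (b t) \<le> \<bar>C\<bar> * cmod (F t)" for t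
  proof (cases "F t = 0")
    case False
    then have "cmod (b t) \<le> \<bar>C\<bar>" using assms(3)[of t] by linarith
    then show ?thesis by (subst mult.commute) (intro mult_right_mono, auto)
  qed simp
  then show "AE t in M. norm (F t * b t) \<le> norm (C *\<^sub>R F t)" by (simp add: norm_mult)
qed

text \<open>A real polynomial on the plane is a polynomial in z and its conjugate, so the integral
  is a combination of the mixed moments.\<close>

lemma integral_mult_poly_eq_0:
  fixes F \<gamma> :: "'a \<Rightarrow> complex"
  assumes F: "integrable M F" and \<gamma>: "\<gamma> \<in> borel_measurable M"
    and \<Gamma>: "compact \<Gamma>" "\<And>t. F t \<noteq> 0 \<Longrightarrow> \<gamma> t \<in> \<Gamma>"
    and moments: "\<And>m n. (LINT t|M. F t * \<gamma> t ^ m * cnj (\<gamma> t) ^ n) = 0"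
    and p: "real_polynomial_function p"
  shows "(LINT t|M. F t * of_real (p (\<gamma> t))) = 0"
proof -
  \<comment> \<open>All monomials in z and its conjugate are built in, so that \<open>S\<close> is
    closed under multiplication by either; continuity gives boundedness on \<open>\<Gamma>\<close>,
    hence integrability.\<close>
  define S where "S = {q :: complex \<Rightarrow> complex. continuous_on UNIV q \<and>
    (\<forall>m n. (LINT t|M. F t * (q (\<gamma> t) * \<gamma> t ^ m * cnj (\<gamma> t) ^ n)) = 0)}"
  have int: "integrable M (\<lambda>t. F t * (q (\<gamma> t) * \<gamma> t ^ m * cnj (\<gamma> t) ^ n))"
    if "continuous_on UNIV q" for q m n
  proof -
    let ?r = "\<lambda>z. q z * z ^ m * cnj z ^ n"
    have cont: "continuous_on UNIV ?r" using that by (intro continuous_intros) auto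
    have "compact (?r ` \<Gamma>)"
      using \<Gamma>(1) cont by (meson compact_continuous_image continuous_on_subset subset_UNIV)
    then obtain C where C: "\<And>z. z \<in> \<Gamma> \<Longrightarrow> cmod (?r z) \<le> C"
      using compact_imp_bounded[of "?r ` \<Gamma>"] by (auto simp: bounded_iff)
    have "?r \<in> borel_measurable borel" using cont by (rule borel_measurable_continuous_onI)
    then have "(\<lambda>t. ?r (\<gamma> t)) \<in> borel_measurable M"
      using \<gamma> by (rule measurable_compose[rotated])
    then show ?thesis using F C \<Gamma>(2) by (intro integrable_mult_bounded) auto
  qed
  have plus: "(\<lambda>z. q z + r z) \<in> S" if "q \<in> S" "r \<in> S" for q r
    using that int[of q] int[of r] unfolding S_def
    by (auto intro!: continuous_intros simp: distrib_left distrib_right)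
  have scale: "(\<lambda>z. c * q z) \<in> S" if "q \<in> S" for q c
  proof -
    have "(LINT t|M. F t * (c * q (\<gamma> t) * \<gamma> t ^ m * cnj (\<gamma> t) ^ n))
        = c * (LINT t|M. F t * (q (\<gamma> t) * \<gamma> t ^ m * cnj (\<gamma> t) ^ n))" for m n
      by (subst integral_mult_right_zero[symmetric]) (simp add: mult_ac)
    with that show ?thesis unfolding S_def by (auto intro!: continuous_intros)
  qed
  have shift: "(\<lambda>z. z * q z) \<in> S" "(\<lambda>z. cnj z * q z) \<in> S" if "q \<in> S" for q
  proof -
    have "(LINT t|M. F t * (q (\<gamma> t) * \<gamma> t ^ m * cnj (\<gamma> t) ^ n)) = 0" for m n
      using that unfolding S_def by auto
    from this[of "Suc _" _] this[of _ "Suc _"] that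
    show "(\<lambda>z. z * q z) \<in> S" "(\<lambda>z. cnj z * q z) \<in> S"
      unfolding S_def by (auto intro!: continuous_intros simp: mult_ac)
  qed
  \<comment> \<open>Quantifying over all of \<open>S\<close> lets the product case feed the output
    of one induction hypothesis into the other.\<close>
  have "\<forall>q\<in>S. (\<lambda>z. of_real (p z) * q z) \<in> S"
    using p
  proof (induction rule: real_polynomial_function.induct)
    case (linear L)
    interpret L: bounded_linear L by fact
    \<comment> \<open>With this \<open>c\<close>, the real-linear functional \<open>L\<close> is
      twice the real part of \<open>c * z\<close>.\<close>
    define c where "c = (of_real (L 1) - \<i> * of_real (L \<i>)) / 2"
    have L_eq: "of_real (L z) = c * z + cnj c * cnj z" for z
    proof -
      have "z = Re z *\<^sub>R 1 + Im z *\<^sub>R \<i>" by (simp add: complex_eq_iff)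
      then have "L z = Re z * L 1 + Im z * L \<i>"
        by (metis L.add L.scaleR real_scaleR_def)
      then show ?thesis by (simp add: c_def complex_eq_iff field_simps)
    qed
    show ?case
    proof
      fix q assume q: "q \<in> S"
      have "(\<lambda>z. c * (z * q z) + cnj c * (cnj z * q z)) \<in> S"
        using q by (intro plus scale shift)
      then show "(\<lambda>z. of_real (L z) * q z) \<in> S" by (simp add: L_eq algebra_simps)
    qed
  next
    case (const c)
    then show ?case using scale by auto
  next
    case (add p1 p2)
    then show ?case using plus by (auto simp: distrib_right)
  next
    case (mult p1 p2)
    show ?case
    proof
      fix q assume "q \<in> S"
      then have "(\<lambda>z. of_real (p1 z) * (of_real (p2 z) * q z)) \<in> S"
        using bspec[OF mult.IH(1) bspec[OF mult.IH(2)]] by simp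
      then show "(\<lambda>z. of_real (p1 z * p2 z) * q z) \<in> S" by (simp add: mult_ac)
    qed
  qed
  moreover have "(\<lambda>z. 1) \<in> S" using moments by (auto simp: S_def mult_ac)
  ultimately have "(\<lambda>z. of_real (p z) * 1) \<in> S" by (rule bspec)
  then have "(LINT t|M. F t * (of_real (p (\<gamma> t)) * 1 * \<gamma> t ^ 0 * cnj (\<gamma> t) ^ 0)) = 0"
    unfolding S_def by blast
  then show ?thesis by simp
qed

text \<open>By Stone-Weierstrass, \<open>\<psi>\<close> is uniformly close on
  \<open>\<Gamma>\<close> to a polynomial, whose integral vanishes; the error is at most e times the
  L1 norm of \<open>F\<close>.\<close>

lemma integral_mult_continuous_eq_0:
  fixes F \<gamma> :: "'a \<Rightarrow> complex" and \<psi> :: "complex \<Rightarrow> complex"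
  assumes F: "integrable M F" and \<gamma>: "\<gamma> \<in> borel_measurable M"
    and \<Gamma>: "compact \<Gamma>" "\<And>t. F t \<noteq> 0 \<Longrightarrow> \<gamma> t \<in> \<Gamma>"
    and moments: "\<And>m n. (LINT t|M. F t * \<gamma> t ^ m * cnj (\<gamma> t) ^ n) = 0"
    and \<psi>: "continuous_on \<Gamma> \<psi>" "\<psi> \<in> borel_measurable borel"
  shows "(LINT t|M. F t * \<psi> (\<gamma> t)) = 0"
proof -
  define J where "J = (LINT t|M. cmod (F t))"
  have J: "J \<ge> 0" by (simp add: J_def)
  have bound: "cmod (LINT t|M. F t * \<psi> (\<gamma> t)) \<le> e * J" if e: "e > 0" for e
  proof -
    obtain g where g: "polynomial_function g" "\<And>z. z \<in> \<Gamma> \<Longrightarrow> norm (\<psi> z - g z) < e"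
      using Stone_Weierstrass_polynomial_function[OF \<Gamma>(1) \<psi>(1) e] by auto
    have poly: "real_polynomial_function (\<lambda>z. Re (g z))" "real_polynomial_function (\<lambda>z. Im (g z))"
      using g(1) bounded_linear_Re bounded_linear_Im
      unfolding polynomial_function_def by (auto simp: o_def)
    have cont: "continuous_on UNIV g" using g(1) by (rule continuous_on_polymonial_function)
    have [measurable]: "g \<in> borel_measurable borel"
      using cont by (rule borel_measurable_continuous_onI)
    note [measurable] = \<gamma> \<psi>(2)
    obtain C where C: "\<And>z. z \<in> \<Gamma> \<Longrightarrow> cmod (g z) \<le> C"
      using compact_imp_bounded[OF compact_continuous_image[OF continuous_on_subset[OF cont] \<Gamma>(1)]]
      by (auto simp: bounded_iff)
    have Re_le: "cmod (of_real (Re (g z))) \<le> C" and Im_le: "cmod (of_real (Im (g z))) \<le> C"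
      if "z \<in> \<Gamma>" for z
      using C[OF that] abs_Re_le_cmod[of "g z"] abs_Im_le_cmod[of "g z"] by auto
    have int_Re: "integrable M (\<lambda>t. F t * of_real (Re (g (\<gamma> t))))"
      and int_Im: "integrable M (\<lambda>t. F t * of_real (Im (g (\<gamma> t))))"
      using \<Gamma>(2) Re_le Im_le by (auto intro!: integrable_mult_bounded[OF F, of _ C])
    have int_g: "integrable M (\<lambda>t. F t * g (\<gamma> t))"
      using \<Gamma>(2) C by (auto intro!: integrable_mult_bounded[OF F, of _ C])
    have "F t * g (\<gamma> t) = F t * of_real (Re (g (\<gamma> t))) + \<i> * (F t * of_real (Im (g (\<gamma> t))))" for t
      using complex_eq[of "g (\<gamma> t)"] by (metis (no_types, lifting) distrib_left mult.left_commute)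
    then have "(LINT t|M. F t * g (\<gamma> t)) =
       (LINT t|M. F t * of_real (Re (g (\<gamma> t)))) + \<i> * (LINT t|M. F t * of_real (Im (g (\<gamma> t))))"
      using int_Re int_Im by simp
    also have "\<dots> = 0"
      using integral_mult_poly_eq_0[OF F \<gamma> \<Gamma> moments poly(1)]
        integral_mult_poly_eq_0[OF F \<gamma> \<Gamma> moments poly(2)] by simp
    finally have g0: "(LINT t|M. F t * g (\<gamma> t)) = 0" .
    have le: "cmod (\<psi> z - g z) \<le> e" if "z \<in> \<Gamma>" for z using g(2)[OF that] by simp
    have int_d: "integrable M (\<lambda>t. F t * (\<psi> (\<gamma> t) - g (\<gamma> t)))"
      using \<Gamma>(2) le by (auto intro!: integrable_mult_bounded[OF F, of _ e])
    have "(LINT t|M. F t * \<psi> (\<gamma> t)) = (LINT t|M. F t * (\<psi> (\<gamma> t) - g (\<gamma> t)) + F t * g (\<gamma> t))"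
      by (simp add: algebra_simps)
    also have "\<dots> = (LINT t|M. F t * (\<psi> (\<gamma> t) - g (\<gamma> t)))"
      using int_d int_g g0 by simp
    also have "cmod \<dots> \<le> (LINT t|M. cmod (F t * (\<psi> (\<gamma> t) - g (\<gamma> t))))"
      by (rule integral_norm_bound)
    also have "\<dots> \<le> (LINT t|M. e * cmod (F t))"
    proof (rule integral_mono)
      show "integrable M (\<lambda>t. e * cmod (F t))" using F by auto
      show "integrable M (\<lambda>t. cmod (F t * (\<psi> (\<gamma> t) - g (\<gamma> t))))" using int_d by auto
      show "cmod (F t * (\<psi> (\<gamma> t) - g (\<gamma> t))) \<le> e * cmod (F t)" for t
        using le[OF \<Gamma>(2)[of t]]
        by (cases "F t = 0") (auto simp: norm_mult mult.commute mult_left_mono)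
    qed
    finally show ?thesis by (simp add: J_def)
  qed
  have "cmod (LINT t|M. F t * \<psi> (\<gamma> t)) \<le> 0"
  proof (rule field_le_epsilon)
    fix e :: real assume "e > 0"
    \<comment> \<open>The norm \<open>J\<close> may be 0, hence the denominator
      \<open>J + 1\<close>.\<close>
    then have "cmod (LINT t|M. F t * \<psi> (\<gamma> t)) \<le> e / (J + 1) * J" using J by (intro bound) auto
    also have "\<dots> \<le> e" using J \<open>e > 0\<close> by (simp add: field_simps)
    finally show "cmod (LINT t|M. F t * \<psi> (\<gamma> t)) \<le> 0 + e" by simp
  qed
  then show ?thesis by simp
qed

text \<open>The indicator of a closed set is the pointwise limit of continuous cut-offs that fall
  linearly with the distance to it; dominated convergence applies.\<close>

lemma integral_mult_indicator_eq_0: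
  fixes F \<gamma> :: "'a \<Rightarrow> complex"
  assumes F: "integrable M F" and \<gamma>: "\<gamma> \<in> borel_measurable M"
    and \<Gamma>: "compact \<Gamma>" "\<And>t. F t \<noteq> 0 \<Longrightarrow> \<gamma> t \<in> \<Gamma>"
    and moments: "\<And>m n. (LINT t|M. F t * \<gamma> t ^ m * cnj (\<gamma> t) ^ n) = 0"
    and K: "closed K"
  shows "(LINT t|M. F t * indicator K (\<gamma> t)) = 0"
\<comment> \<open>\<open>infdist\<close> to the empty set is 0 by convention, so the cut-offs would
  be constantly 1 although the indicator is 0.\<close>
proof (cases "K = {}")
  case False
  define \<psi> :: "nat \<Rightarrow> complex \<Rightarrow> complex"
    where "\<psi> j z = of_real (max 0 (1 - real j * infdist z K))" for j z
  have cont: "continuous_on UNIV (\<psi> j)" for j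
    unfolding \<psi>_def by (intro continuous_intros)
  have meas[measurable]: "\<psi> j \<in> borel_measurable borel" for j
    using cont by (rule borel_measurable_continuous_onI)
  note [measurable] = \<gamma>
  have [measurable]: "F \<in> borel_measurable M" using F by auto
  have [measurable]: "K \<in> sets borel" using K by auto
  have lim: "(\<lambda>j. \<psi> j z) \<longlonglongrightarrow> indicator K z" for z
  proof (cases "z \<in> K")
    case True
    then show ?thesis by (simp add: \<psi>_def)
  next
    case z: False
    then have pos: "infdist z K > 0"
      using K False in_closed_iff_infdist_zero infdist_nonneg by (metis order_less_le)
    have "eventually (\<lambda>j. real j > 1 / infdist z K) sequentially"
      using filterlim_real_sequentially by (simp add: filterlim_at_top_dense)
    then have "eventually (\<lambda>j. \<psi> j z = 0) sequentially"
    proof eventually_elim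
      case (elim j)
      then have "1 - real j * infdist z K \<le> 0" using pos by (simp add: field_simps)
      then show ?case by (simp add: \<psi>_def max_def)
    qed
    then show ?thesis using z by (simp add: tendsto_eventually)
  qed
  have le: "cmod (\<psi> j z) \<le> 1" for j z
    using infdist_nonneg[of z K] by (simp add: \<psi>_def)
  have "(\<lambda>j. LINT t|M. F t * \<psi> j (\<gamma> t)) \<longlonglongrightarrow> (LINT t|M. F t * indicator K (\<gamma> t))"
  proof (rule integral_dominated_convergence)
    show "integrable M (\<lambda>t. cmod (F t))" using F by auto
    show "AE t in M. (\<lambda>j. F t * \<psi> j (\<gamma> t)) \<longlonglongrightarrow> F t * indicator K (\<gamma> t)"
      using lim by (auto intro!: tendsto_intros)
    show "AE t in M. cmod (F t * \<psi> j (\<gamma> t)) \<le> cmod (F t)" for j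
      using le by (auto simp: norm_mult mult_left_le)
  qed measurable
  moreover have "(LINT t|M. F t * \<psi> j (\<gamma> t)) = 0" for j
    using cont by (intro integral_mult_continuous_eq_0[OF F \<gamma> \<Gamma> moments] meas)
       (auto intro: continuous_on_subset)
  ultimately show ?thesis by (simp add: LIMSEQ_const_iff)
qed simp

text \<open>On a compact set where \<open>g\<close> is positive, the zero integral forces measure
  zero. Inner regularity carries this over to the whole set where \<open>g\<close> is
  positive.\<close>

lemma AE_nonpos_if_integral_compact_eq_0:
  fixes g :: "real \<Rightarrow> real"
  assumes g: "integrable lborel g"
    and zero: "\<And>C. compact C \<Longrightarrow> (LINT t|lborel. g t * indicator C t) = 0"
  shows "AE t in lborel. g t \<le> 0"
proof -
  define A where "A = {t. g t > 0}"
  have [measurable]: "g \<in> borel_measurable borel" using g by auto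
  have A[measurable]: "A \<in> sets borel" unfolding A_def by measurable
  have compact_null: "C \<in> null_sets lborel" if C: "compact C" "C \<subseteq> A" for C
  proof -
    have [measurable]: "C \<in> sets borel" using C(1) by (rule borel_compact)
    have "AE t in lborel. g t * indicator C t = 0"
    proof (subst integral_nonneg_eq_0_iff_AE[symmetric])
      show "integrable lborel (\<lambda>t. g t * indicator C t)"
        using g by (intro integrable_real_mult_indicator) auto
      show "AE t in lborel. 0 \<le> g t * indicator C t"
        using C(2) by (intro AE_I2) (auto simp: A_def less_imp_le subset_iff split: split_indicator)
    qed (use zero C in simp)
    then have "AE t in lborel. t \<notin> C"
      by eventually_elim (use C(2) in \<open>auto simp: A_def indicator_def split: if_splits\<close>)
    then show ?thesis by (subst AE_iff_null_sets) auto
  qed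
  have small: "emeasure lborel A \<le> ennreal e" if e: "e > 0" for e
  proof -
    have "A \<in> sets lebesgue" using A by simp
    then obtain T where T: "closed T" "T \<subseteq> A" "A - T \<in> lmeasurable"
        "emeasure lebesgue (A - T) < ennreal e"
      by (rule sets_lebesgue_inner_closed[OF _ e])
    have [measurable]: "T \<in> sets borel" using T(1) by auto
    \<comment> \<open>\<open>T\<close> may be unbounded, so it is cut into countably many compact
      pieces.\<close>
    have "T = (\<Union>n::nat. T \<inter> cball 0 (real n))"
      using real_arch_simple by fastforce
    moreover have "T \<inter> cball 0 (real n) \<in> null_sets lborel" for n :: nat
      using T(1,2) by (intro compact_null closed_Int_compact) auto
    then have "(\<Union>n::nat. T \<inter> cball 0 (real n)) \<in> null_sets lborel"
      by (intro null_sets_UN) auto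
    ultimately have "T \<in> null_sets lborel" by simp
    then have "emeasure lborel (A - T) = emeasure lborel A"
      by (intro emeasure_Diff_null_set) auto
    with T(4) show ?thesis by simp
  qed
  have "emeasure lborel A \<le> 0" by (rule ennreal_le_epsilon) (use small in simp)
  then have "A \<in> null_sets lborel" by (simp add: null_sets_def)
  then have "AE t in lborel. t \<notin> A" by (rule AE_not_in)
  then show ?thesis by eventually_elim (auto simp: A_def)
qed

lemma AE_eq_0_if_integral_compact_eq_0:
  fixes F :: "real \<Rightarrow> complex"
  assumes F: "integrable lborel F"
    and zero: "\<And>C. compact C \<Longrightarrow> (LINT t|lborel. F t * indicator C t) = 0"
  shows "AE t in lborel. F t = 0"
proof -
  have int: "integrable lborel (\<lambda>t. F t * indicator C t)" if "compact C" for C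
    using F borel_compact[OF that] by (intro integrable_mult_bounded[of _ _ _ 1]) (auto split: split_indicator)
  have Re: "(LINT t|lborel. Re (F t) * indicator C t) = 0" if "compact C" for C
  proof -
    have "Re (F t) * indicator C t = Re (F t * indicator C t)" for t
      by (simp split: split_indicator)
    then show ?thesis by (simp only: integral_Re[OF int[OF that]] zero[OF that] zero_complex.simps)
  qed
  have Im: "(LINT t|lborel. Im (F t) * indicator C t) = 0" if "compact C" for C
  proof -
    have "Im (F t) * indicator C t = Im (F t * indicator C t)" for t
      by (simp split: split_indicator)
    then show ?thesis by (simp only: integral_Im[OF int[OF that]] zero[OF that] zero_complex.simps)
  qed
  have "AE t in lborel. Re (F t) \<le> 0" "AE t in lborel. - Re (F t) \<le> 0"
       "AE t in lborel. Im (F t) \<le> 0" "AE t in lborel. - Im (F t) \<le> 0"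
    using F Re Im by (auto intro!: AE_nonpos_if_integral_compact_eq_0 simp del: neg_le_0_iff_le)
  then show ?thesis by eventually_elim (auto simp: complex_eq_iff)
qed

text \<open>The exponential is injective, so each compact \<open>C\<close> is the preimage of its
  compact image, and vanishing moments make the integral over \<open>C\<close> vanish.\<close>

lemma AE_eq_0_if_exponential_moments_eq_0:
  fixes F :: "real \<Rightarrow> complex" and s :: real
  assumes F: "integrable lborel F" and supp: "compact D" "\<And>t. F t \<noteq> 0 \<Longrightarrow> t \<in> D"
    and s: "s \<noteq> 0" and moments: "\<And>n::nat. (LINT t|lborel. F t * of_real (exp (s * t)) ^ n) = 0"
  shows "AE t in lborel. F t = 0"
proof (rule AE_eq_0_if_integral_compact_eq_0[OF F])
  fix C :: "real set" assume C: "compact C"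
  define \<gamma> :: "real \<Rightarrow> complex" where "\<gamma> t = of_real (exp (s * t))" for t
  have cont: "continuous_on X \<gamma>" for X unfolding \<gamma>_def by (intro continuous_intros)
  have "(LINT t|lborel. F t * indicator (\<gamma> ` C) (\<gamma> t)) = 0"
  proof (rule integral_mult_indicator_eq_0[OF F])
    show "\<gamma> \<in> borel_measurable lborel" using cont by (auto intro: borel_measurable_continuous_onI)
    show "compact (\<gamma> ` D)" using cont supp(1) by (rule compact_continuous_image)
    show "F t \<noteq> 0 \<Longrightarrow> \<gamma> t \<in> \<gamma> ` D" for t using supp(2) by blast
    \<comment> \<open>\<open>\<gamma>\<close> is real-valued, so mixed moments are ordinary moments
      of order \<open>m + n\<close>.\<close>
    show "(LINT t|lborel. F t * \<gamma> t ^ m * cnj (\<gamma> t) ^ n) = 0" for m n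
      using moments[of "m + n"] by (simp add: \<gamma>_def power_add mult.assoc)
    show "closed (\<gamma> ` C)" using cont C by (intro compact_imp_closed compact_continuous_image)
  qed
  moreover have "inj \<gamma>" using s by (auto simp: inj_def \<gamma>_def)
  then have "indicator (\<gamma> ` C) (\<gamma> t) = (indicator C t :: complex)" for t
    by (simp add: indicator_def inj_image_mem_iff)
  ultimately show "(LINT t|lborel. F t * indicator C t) = 0" by simp
qed

text \<open>The line is wound around the unit circle with period N + 1. The mixed moments are values
  of the transform at multiples of 1 / (N + 1), so the integral of \<open>F\<close> over the
  periodization of a compact set vanishes. As N grows, the nontrivial translates leave every bounded
  region.\<close>

lemma AE_eq_0_if_fourier_L1_eq_0:
  assumes F: "integrable lborel F" and zero: "\<And>\<xi>. fourier_L1 F \<xi> = 0"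
  shows "AE t in lborel. F t = 0"
proof (rule AE_eq_0_if_integral_compact_eq_0[OF F])
  fix C :: "real set" assume C: "compact C"
  then obtain R where R: "\<And>t. t \<in> C \<Longrightarrow> \<bar>t\<bar> \<le> R"
    using compact_imp_bounded[of C] by (auto simp: bounded_iff)
  define \<gamma> :: "nat \<Rightarrow> real \<Rightarrow> complex"
    where "\<gamma> N t = exp (2 * pi * \<i> * (t / real (Suc N)))" for N t
  have cont: "continuous_on X (\<gamma> N)" for X N unfolding \<gamma>_def by (intro continuous_intros) auto
  have meas[measurable]: "\<gamma> N \<in> borel_measurable borel" for N
    using cont by (auto intro: borel_measurable_continuous_onI)
  have [measurable]: "F \<in> borel_measurable borel" using F by auto
  have closed: "closed (\<gamma> N ` C)" for N
    using cont C by (intro compact_imp_closed compact_continuous_image)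
  have [measurable]: "\<gamma> N ` C \<in> sets borel" for N using closed by auto
  have [measurable]: "C \<in> sets borel" using C by (rule borel_compact)
  have zero_N: "(LINT t|lborel. F t * indicator (\<gamma> N ` C) (\<gamma> N t)) = 0" for N
  proof (rule integral_mult_indicator_eq_0[OF F, where \<Gamma> = "sphere 0 1"])
    show "F t \<noteq> 0 \<Longrightarrow> \<gamma> N t \<in> sphere 0 1" for t by (simp add: \<gamma>_def)
    show "(LINT t|lborel. F t * \<gamma> N t ^ m * cnj (\<gamma> N t) ^ n) = 0" for m n
    proof -
      have "\<gamma> N t ^ m * cnj (\<gamma> N t) ^ n
          = exp (- 2 * complex_of_real pi * \<i> * of_real t * of_real ((real n - real m) / real (Suc N)))" for t
        unfolding \<gamma>_def exp_cnj exp_of_nat_mult[symmetric] exp_add[symmetric]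
        by (rule arg_cong[where f = exp]) (simp add: diff_divide_distrib algebra_simps)
      then show ?thesis
        using zero[of "(real n - real m) / real (Suc N)"] by (simp add: fourier_L1_def mult.assoc)
    qed
  qed (use closed in auto)
  have lim: "(\<lambda>N. indicator (\<gamma> N ` C) (\<gamma> N t) :: complex) \<longlonglongrightarrow> indicator C t" for t
  proof (cases "t \<in> C")
    case True
    then show ?thesis by simp
  next
    case False
    have "eventually (\<lambda>N. real N > \<bar>t\<bar> + R) sequentially"
      using filterlim_real_sequentially by (simp add: filterlim_at_top_dense)
    then have "eventually (\<lambda>N. indicator (\<gamma> N ` C) (\<gamma> N t) = (0::complex)) sequentially"
    proof eventually_elim
      case (elim N)
      \<comment> \<open>Equal images make \<open>t - c\<close> a multiple of N + 1; being smaller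
        than N + 1 in absolute value, it is 0.\<close>
      have "\<gamma> N t \<notin> \<gamma> N ` C"
      proof
        assume "\<gamma> N t \<in> \<gamma> N ` C"
        then obtain c where c: "c \<in> C" "\<gamma> N t = \<gamma> N c" by auto
        then obtain k :: int where
          "2 * pi * \<i> * (t / real (Suc N)) = 2 * pi * \<i> * (c / real (Suc N)) + (of_int (2 * k) * pi) * \<i>"
          unfolding \<gamma>_def exp_eq by auto
        then have "2 * pi * (t / real (Suc N)) = 2 * pi * (c / real (Suc N)) + of_int (2 * k) * pi"
          by (simp add: complex_eq_iff)
        then have "2 * pi * (t / real (Suc N)) = 2 * pi * (c / real (Suc N) + of_int k)"
          by (simp add: algebra_simps)
        then have "t / real (Suc N) = c / real (Suc N) + of_int k"
          unfolding mult_cancel_left by simp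
        then have eq: "t - c = of_int k * real (Suc N)" by (simp add: field_simps)
        have "\<bar>t - c\<bar> < real (Suc N)" using R[OF c(1)] elim by linarith
        then have "\<bar>of_int k :: real\<bar> < 1" unfolding eq by (simp add: abs_mult)
        then have "k = 0" by linarith
        with eq c False show False by simp
      qed
      then show ?case by simp
    qed
    then show ?thesis using False by (simp add: tendsto_eventually)
  qed
  have "(\<lambda>N. LINT t|lborel. F t * indicator (\<gamma> N ` C) (\<gamma> N t)) \<longlonglongrightarrow> (LINT t|lborel. F t * indicator C t)"
  proof (rule integral_dominated_convergence)
    show "integrable lborel (\<lambda>t. cmod (F t))" using F by auto
    show "AE t in lborel. (\<lambda>N. F t * indicator (\<gamma> N ` C) (\<gamma> N t)) \<longlonglongrightarrow> F t * indicator C t"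
      using lim by (auto intro!: tendsto_mult)
    show "AE t in lborel. cmod (F t * indicator (\<gamma> N ` C) (\<gamma> N t)) \<le> cmod (F t)" for N
      by (auto simp: indicator_def)
  qed measurable
  then show "(LINT t|lborel. F t * indicator C t) = 0" by (simp add: zero_N LIMSEQ_const_iff)
qed

subsection \<open>Entire functions with equal modulus on two lines\<close>

definition fourier_laplace :: "(real \<Rightarrow> complex) \<Rightarrow> complex \<Rightarrow> complex" where
  "fourier_laplace k z = (LINT \<xi>|lborel. k \<xi> * exp (2 * complex_of_real pi * \<i> * z * of_real \<xi>))"

text \<open>Expanding the exponential and integrating termwise gives a power series in z. Bounded
  support controls its n-th term by a multiple of r ^ n / n!, so it converges everywhere.\<close>

lemma fourier_laplace_holomorphic:
  assumes k: "integrable lborel k" and supp: "\<And>\<xi>. k \<xi> \<noteq> 0 \<Longrightarrow> \<xi> \<in> {-B..B}"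
  shows "fourier_laplace k holomorphic_on UNIV"
proof -
  define a where "a n = (LINT \<xi>|lborel. k \<xi> * (2 * complex_of_real pi * \<i> * of_real \<xi>) ^ n /\<^sub>R fact n)" for n
  have sums: "(\<lambda>n. a n * (z - 0) ^ n) sums fourier_laplace k z" for z
  proof -
    define r where "r = 2 * pi * cmod z * \<bar>B\<bar>"
    define f where "f n \<xi> = k \<xi> * ((2 * complex_of_real pi * \<i> * z * of_real \<xi>) ^ n /\<^sub>R fact n)" for n \<xi>
    have bound: "cmod ((2 * complex_of_real pi * \<i> * z * of_real \<xi>) ^ n /\<^sub>R fact n) \<le> r ^ n /\<^sub>R fact n"
      if "k \<xi> \<noteq> 0" for \<xi> n
    proof -
      have "\<bar>\<xi>\<bar> \<le> \<bar>B\<bar>" using supp[OF that] by auto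
      then have "cmod (2 * complex_of_real pi * \<i> * z * of_real \<xi>) \<le> r"
        unfolding r_def by (simp add: norm_mult mult_left_mono)
      then have le: "cmod ((2 * complex_of_real pi * \<i> * z * of_real \<xi>) ^ n) \<le> r ^ n"
        unfolding norm_power by (rule power_mono) simp
      show ?thesis unfolding norm_scaleR real_scaleR_def by (rule mult_mono[OF _ le]) auto
    qed
    have int: "integrable lborel (f n)" for n
      unfolding f_def by (rule integrable_mult_bounded[OF k _ bound]) auto
    have f_le: "cmod (f n \<xi>) \<le> cmod (k \<xi>) * (r ^ n /\<^sub>R fact n)" for n \<xi>
    proof (cases "k \<xi> = 0")
      case False
      then show ?thesis unfolding f_def norm_mult by (intro mult_left_mono bound) auto
    qed (simp add: f_def)
    have r: "summable (\<lambda>n. r ^ n /\<^sub>R fact n)" by (rule summable_exp_generic)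
    have f_sums: "(\<lambda>n. f n \<xi>) sums (k \<xi> * exp (2 * complex_of_real pi * \<i> * z * of_real \<xi>))" for \<xi>
      unfolding f_def by (intro sums_mult exp_converges)
    have "(\<lambda>n. integral\<^sup>L lborel (f n)) sums (LINT \<xi>|lborel. (\<Sum>n. f n \<xi>))"
    proof (rule sums_integral[OF int])
      have "summable (\<lambda>n. cmod (f n \<xi>))" for \<xi>
        by (rule summable_comparison_test'[OF summable_mult[OF r, of "cmod (k \<xi>)"]])
           (simp only: real_norm_def abs_norm_cancel f_le)
      then show "AE \<xi> in lborel. summable (\<lambda>n. norm (f n \<xi>))" by simp
      show "summable (\<lambda>n. LINT \<xi>|lborel. norm (f n \<xi>))"
      proof (rule summable_comparison_test'[OF summable_mult[OF r, of "LINT \<xi>|lborel. cmod (k \<xi>)"]])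
        fix n :: nat
        have "(LINT \<xi>|lborel. norm (f n \<xi>)) \<le> (LINT \<xi>|lborel. cmod (k \<xi>) * (r ^ n /\<^sub>R fact n))"
          using int k f_le by (intro integral_mono) auto
        then show "norm (LINT \<xi>|lborel. norm (f n \<xi>)) \<le> (LINT \<xi>|lborel. cmod (k \<xi>)) * (r ^ n /\<^sub>R fact n)"
          by simp
      qed
    qed
    moreover have "integral\<^sup>L lborel (f n) = a n * (z - 0) ^ n" for n
    proof -
      have "f n = (\<lambda>\<xi>. (k \<xi> * (2 * complex_of_real pi * \<i> * of_real \<xi>) ^ n /\<^sub>R fact n) * z ^ n)"
        by (rule ext) (simp add: f_def power_mult_distrib)
      then show ?thesis by (simp add: a_def)
    qed
    moreover have "(\<Sum>n. f n \<xi>) = k \<xi> * exp (2 * complex_of_real pi * \<i> * z * of_real \<xi>)" for \<xi>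
      using f_sums by (rule sums_unique[symmetric])
    ultimately show ?thesis by (simp add: fourier_laplace_def)
  qed
  have "fourier_laplace k field_differentiable at z" for z
  proof -
    have "fourier_laplace k holomorphic_on ball 0 (cmod z + 1)"
      using sums by (rule power_series_holomorphic)
    then show ?thesis by (rule holomorphic_on_imp_differentiable_at) auto
  qed
  then show ?thesis by (simp add: holomorphic_on_def field_differentiable_at_within)
qed

section \<open>Identity theorem and reflection in horizontal lines\<close>

lemma uncountable_horizontal_line: "uncountable (range (\<lambda>x. Complex x a))"
proof -
  have "inj (\<lambda>x. Complex x a)" by (simp add: inj_def)
  then show ?thesis using uncountable_UNIV_real countable_image_inj_on by blast
qed

text \<open>Distinct entire functions agree at only countably many points, whereas a line is
  uncountable.\<close>

lemma holomorphic_eq_if_eq_on_line: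
  assumes "f holomorphic_on UNIV" "g holomorphic_on UNIV" "\<And>x. f (Complex x a) = g (Complex x a)"
  shows "f = g"
proof (rule holomorphic_countable_equal_UNIV[OF assms(1,2)])
  have "range (\<lambda>x. Complex x a) \<subseteq> {z. f z = g z}" using assms(3) by auto
  then show "uncountable {z. f z = g z}"
    using uncountable_horizontal_line countable_subset by blast
qed

text \<open>Conjugating both argument and value preserves holomorphy. For w = 2 a i this is the
  Schwarz reflection of \<open>f\<close> in the line of height a.\<close>

lemma holomorphic_reflect:
  assumes "f holomorphic_on UNIV"
  shows "(\<lambda>z. cnj (f (cnj z + w))) holomorphic_on UNIV"
proof -
  have "(\<lambda>z. f (z + w)) holomorphic_on UNIV"
    using holomorphic_on_compose_gen[of "\<lambda>z. z + w" UNIV f UNIV] assms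
    by (simp add: o_def holomorphic_on_add holomorphic_on_ident)
  then have "cnj \<circ> (\<lambda>z. f (z + w)) \<circ> cnj holomorphic_on UNIV"
    by (intro holomorphic_on_compose_cnj_cnj) (auto intro: holomorphic_on_subset)
  then show ?thesis by (simp add: o_def)
qed

text \<open>The reflection fixes the line of height \<open>a\<close>, where the two sides are the
  squared moduli of \<open>P\<close> and \<open>Q\<close>. Both sides are entire in
  \<open>z\<close>, so the equality spreads to the plane.\<close>

lemma reflection_identity:
  assumes P: "P holomorphic_on UNIV" and Q: "Q holomorphic_on UNIV"
    and eq: "\<And>x. cmod (P (Complex x a)) = cmod (Q (Complex x a))"
  shows "P z * cnj (P (cnj z + 2 * a * \<i>)) = Q z * cnj (Q (cnj z + 2 * a * \<i>))"
proof -
  have refl: "cnj (Complex x a) + 2 * a * \<i> = Complex x a" for x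
    by (simp add: complex_eq_iff)
  have "(\<lambda>z. P z * cnj (P (cnj z + 2 * a * \<i>))) = (\<lambda>z. Q z * cnj (Q (cnj z + 2 * a * \<i>)))"
  proof (rule holomorphic_eq_if_eq_on_line)
    show "(\<lambda>z. P z * cnj (P (cnj z + 2 * a * \<i>))) holomorphic_on UNIV"
      "(\<lambda>z. Q z * cnj (Q (cnj z + 2 * a * \<i>))) holomorphic_on UNIV"
      using P Q by (auto intro!: holomorphic_on_mult holomorphic_reflect)
    show "P (Complex x a) * cnj (P (cnj (Complex x a) + 2 * a * \<i>)) =
          Q (Complex x a) * cnj (Q (cnj (Complex x a) + 2 * a * \<i>))" for x
      unfolding refl using eq[of x] by (simp add: complex_norm_square[symmetric])
  qed
  from fun_cong[OF this] show ?thesis by simp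
qed

text \<open>By the two reflection identities, P / Q is invariant under the composition of both
  reflections, a vertical translation by 2 (b - a). Its value at height \<open>a\<close> is
  unimodular and recurs at every translate.\<close>

lemma unimodular_ratio_on_two_lines:
  fixes a b :: real
  assumes P: "P holomorphic_on UNIV" and Q: "Q holomorphic_on UNIV"
    and eqa: "\<And>x. cmod (P (Complex x a)) = cmod (Q (Complex x a))"
    and eqb: "\<And>x. cmod (P (Complex x b)) = cmod (Q (Complex x b))"
  obtains c x where "cmod c = 1"
    "\<And>n::nat. P (Complex x (a + real n * (2 * (b - a)))) = c * Q (Complex x (a + real n * (2 * (b - a))))"
proof (cases "P = (\<lambda>_. 0) \<or> Q = (\<lambda>_. 0)")
  case True
  have zero: "P = (\<lambda>_. 0)" if "Q = (\<lambda>_. 0)"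
    using eqa that by (intro holomorphic_eq_if_eq_on_line[OF P, of _ a]) auto
  have "Q = (\<lambda>_. 0)" if "P = (\<lambda>_. 0)"
    using eqa that by (intro holomorphic_eq_if_eq_on_line[OF Q, of _ a]) auto
  with zero True have "P = (\<lambda>_. 0)" "Q = (\<lambda>_. 0)" by auto
  then show thesis using that[of 1 0] by simp
next
  case False
  have "countable {z. P z = 0}" "countable {z. Q z = 0}"
    using False holomorphic_countable_equal_UNIV[OF P, of "\<lambda>_. 0"]
      holomorphic_countable_equal_UNIV[OF Q, of "\<lambda>_. 0"] by auto
  \<comment> \<open>The zeros are countable, so some vertical line avoids them all and the ratio is
    defined along it.\<close>
  then have "countable (Re ` ({z. P z = 0} \<union> {z. Q z = 0}))" by auto
  then obtain x where "x \<notin> Re ` ({z. P z = 0} \<union> {z. Q z = 0})"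
    using uncountable_UNIV_real by (metis UNIV_eq_I)
  then have nz: "P (Complex x y) \<noteq> 0" "Q (Complex x y) \<noteq> 0" for y
    by force+
  define R where "R y = P (Complex x y) / Q (Complex x y)" for y
  have period: "R (y + 2 * (b - a)) = R y" for y
  proof -
    \<comment> \<open>The reflections of this \<open>z\<close> in the lines of heights a and b are
      the points of heights \<open>y\<close> and \<open>y + 2 * (b - a)\<close>.\<close>
    define z where "z = Complex x (2 * a - y)"
    have "cnj z + 2 * a * \<i> = Complex x y" "cnj z + 2 * b * \<i> = Complex x (y + 2 * (b - a))"
      by (simp_all add: z_def complex_eq_iff)
    with reflection_identity[OF P Q eqa, of z] reflection_identity[OF P Q eqb, of z]
    have "P z * cnj (P (Complex x y)) = Q z * cnj (Q (Complex x y))"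
      "P z * cnj (P (Complex x (y + 2 * (b - a)))) = Q z * cnj (Q (Complex x (y + 2 * (b - a))))"
      by simp_all
    then have "cnj (R y) = Q z / P z" "cnj (R (y + 2 * (b - a))) = Q z / P z"
      using nz[of y] nz[of "y + 2 * (b - a)"] nz[of "2 * a - y"]
      by (simp_all add: R_def z_def field_simps)
    then show ?thesis by (metis complex_cnj_cancel_iff)
  qed
  have "R (a + real n * (2 * (b - a))) = R a" for n
  proof (induction n)
    case (Suc n)
    have "R (a + real (Suc n) * (2 * (b - a))) = R ((a + real n * (2 * (b - a))) + 2 * (b - a))"
      by (rule arg_cong[where f = R]) (simp add: algebra_simps)
    with period Suc.IH show ?case by (simp only:)
  qed simp
  then have "P (Complex x (a + real n * (2 * (b - a)))) = R a * Q (Complex x (a + real n * (2 * (b - a))))" for n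
    using nz[of "a + real n * (2 * (b - a))"] unfolding R_def by (metis nonzero_eq_divide_eq)
  moreover have "cmod (R a) = 1" using nz[of a] eqa[of x] by (simp add: R_def norm_divide)
  ultimately show thesis using that by blast
qed

subsection \<open>Sampling the modulus of a band-limited function\<close>

lemma
  fixes f g :: "real \<Rightarrow> complex"
  assumes f: "integrable lborel f" and g: "integrable lborel g"
  shows integrable_lborel_times: "integrable (lborel \<Otimes>\<^sub>M lborel) (\<lambda>p. f (fst p) * g (snd p))"
    and integral_lborel_times: "(LINT p|(lborel \<Otimes>\<^sub>M lborel). f (fst p) * g (snd p)) = integral\<^sup>L lborel f * integral\<^sup>L lborel g"
proof -
  have [measurable]: "f \<in> borel_measurable borel" "g \<in> borel_measurable borel" using f g by auto
  show int: "integrable (lborel \<Otimes>\<^sub>M lborel) (\<lambda>p. f (fst p) * g (snd p))"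
    using f g by (intro lborel_pair.Fubini_integrable) (auto simp: norm_mult)
  show "(LINT p|(lborel \<Otimes>\<^sub>M lborel). f (fst p) * g (snd p)) = integral\<^sup>L lborel f * integral\<^sup>L lborel g"
    using lborel_pair.integral_fst'[OF int] by simp
qed

text \<open>The squared modulus is a double integral over the square of side [-B, B] against an
  exponential in \<open>\<xi> - \<eta>\<close>. This difference lies in [-2B, 2B], an interval that
  mesh 1 / (4B) wraps exactly once around the circle. Hence, up to the endpoints, each such
  exponential is a function of \<open>\<gamma>\<close>.\<close>

lemma cmod_fourier_laplace_eq_if_eq_on_grid:
  fixes B x :: real and k m :: "real \<Rightarrow> complex"
  assumes B: "B > 0" and k: "integrable lborel k" and m: "integrable lborel m"
    and supp: "\<And>\<xi>. k \<xi> \<noteq> 0 \<or> m \<xi> \<noteq> 0 \<Longrightarrow> \<xi> \<in> {-B..B}"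
    and grid: "\<And>j::int. cmod (fourier_laplace k (of_real (1 / (4 * B) * of_int j)))
                 = cmod (fourier_laplace m (of_real (1 / (4 * B) * of_int j)))"
  shows "cmod (fourier_laplace k (of_real x)) = cmod (fourier_laplace m (of_real x))"
proof -
  let ?M = "lborel \<Otimes>\<^sub>M lborel :: (real \<times> real) measure"
  define e where "e y \<xi> = exp (2 * complex_of_real pi * \<i> * of_real y * of_real \<xi>)" for y \<xi> :: real
  \<comment> \<open>The kernel whose integrals against the exponentials are the differences of the
    squared moduli.\<close>
  define K where "K p = k (fst p) * cnj (k (snd p)) - m (fst p) * cnj (m (snd p))" for p
  have e_borel[measurable]: "e y \<in> borel_measurable borel" for y unfolding e_def by measurable
  have norm_e: "cmod (e y \<xi>) = 1" for y \<xi> by (simp add: e_def)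
  have e_diff: "e y (\<xi> - \<eta>) = e y \<xi> * cnj (e y \<eta>)" for y \<xi> \<eta>
    unfolding e_def exp_cnj exp_add[symmetric] by (rule arg_cong[where f = exp]) (simp add: algebra_simps)
  have int_K: "integrable ?M K"
    unfolding K_def using k m
    by (intro Bochner_Integration.integrable_diff integrable_lborel_times integrable_cnj) auto
  note [measurable] = borel_measurable_integrable[OF int_K]
  have sq: "integrable ?M (\<lambda>p. h (fst p) * cnj (h (snd p)) * e y (fst p - snd p))"
      "(LINT p|?M. h (fst p) * cnj (h (snd p)) * e y (fst p - snd p))
        = of_real ((cmod (fourier_laplace h (of_real y)))\<^sup>2)"
    if h: "integrable lborel h" for h :: "real \<Rightarrow> complex" and y
  proof -
    have he: "integrable lborel (\<lambda>\<xi>. h \<xi> * e y \<xi>)"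
      using h by (rule integrable_mult_bounded[of _ _ _ 1]) (simp_all add: norm_e)
    have eq: "h (fst p) * cnj (h (snd p)) * e y (fst p - snd p)
        = (h (fst p) * e y (fst p)) * cnj (h (snd p) * e y (snd p))" for p
      by (simp add: e_diff)
    show "integrable ?M (\<lambda>p. h (fst p) * cnj (h (snd p)) * e y (fst p - snd p))"
      unfolding eq using he integrable_cnj[OF he] by (rule integrable_lborel_times)
    have "(LINT p|?M. h (fst p) * cnj (h (snd p)) * e y (fst p - snd p))
        = (LINT \<xi>|lborel. h \<xi> * e y \<xi>) * (LINT \<xi>|lborel. cnj (h \<xi> * e y \<xi>))"
      unfolding eq using he integrable_cnj[OF he] by (rule integral_lborel_times)
    also have "\<dots> = of_real ((cmod (fourier_laplace h (of_real y)))\<^sup>2)"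
      unfolding Bochner_Integration.integral_cnj complex_norm_square fourier_laplace_def e_def ..
    finally show "(LINT p|?M. h (fst p) * cnj (h (snd p)) * e y (fst p - snd p))
        = of_real ((cmod (fourier_laplace h (of_real y)))\<^sup>2)" .
  qed
  have int_Ke: "(LINT p|?M. K p * e y (fst p - snd p)) =
      of_real ((cmod (fourier_laplace k (of_real y)))\<^sup>2) - of_real ((cmod (fourier_laplace m (of_real y)))\<^sup>2)" for y
    unfolding K_def left_diff_distrib
    by (subst Bochner_Integration.integral_diff) (simp_all only: sq[OF k] sq[OF m])
  define \<gamma> where "\<gamma> p = e (1 / (4 * B)) (fst p - snd p)" for p
  have \<gamma>_borel[measurable]: "\<gamma> \<in> borel_measurable ?M" unfolding \<gamma>_def by measurable
  have \<gamma>_sphere: "\<gamma> p \<in> sphere 0 1" for p by (simp add: \<gamma>_def norm_e)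
  \<comment> \<open>Conjugates are inverses on the circle, so the moment of orders \<open>a\<close>
    and \<open>b\<close> belongs to the grid point of index a - b, where the moduli agree.\<close>
  have moments: "(LINT p|?M. K p * \<gamma> p ^ a * cnj (\<gamma> p) ^ b) = 0" for a b
  proof -
    have "\<gamma> p ^ a * cnj (\<gamma> p) ^ b = e (1 / (4 * B) * of_int (int a - int b)) (fst p - snd p)" for p
      unfolding \<gamma>_def e_def exp_cnj exp_of_nat_mult[symmetric] exp_add[symmetric]
      by (rule arg_cong[where f = exp]) (use B in \<open>simp add: field_simps\<close>)
    then show ?thesis
      by (simp only: mult.assoc int_Ke grid diff_self)
  qed
  \<comment> \<open>\<open>z \<mapsto> exp (4 B x Ln z)\<close> is the character with frequency \<open>x\<close>, up to a jump at \<open>-1\<close>, which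
    \<open>\<gamma>\<close> attains only at the two corners of the square; the factor with \<open>min\<close> removes the jump.\<close>
  define \<psi> where "\<psi> j z = of_real (min 1 (real j * cmod (z + 1))) * exp (of_real (4 * B * x) * Ln z)"
    for j :: nat and z
  have \<psi>_borel[measurable]: "\<psi> j \<in> borel_measurable borel" for j
    unfolding \<psi>_def by measurable
  have norm_exp_Ln: "cmod (exp (of_real c * Ln z)) = 1" if "cmod z = 1" for c z
  proof -
    have "z \<noteq> 0" using that by auto
    then show ?thesis using that by simp
  qed
  have \<psi>_le: "cmod (\<psi> j z) \<le> min 1 (real j * cmod (z + 1))" if "cmod z = 1" for j z
    using norm_exp_Ln[OF that, of "4 * B * x"] by (simp add: \<psi>_def norm_mult del: norm_exp_eq_Re)
  have \<psi>_cont: "continuous_on (sphere 0 1) (\<psi> j)" for j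
    unfolding continuous_on_eq_continuous_within
  proof
    fix z :: complex assume z: "z \<in> sphere 0 1"
    show "continuous (at z within sphere 0 1) (\<psi> j)"
    proof (cases "z = -1")
      case True
      \<comment> \<open>The logarithm jumps at -1, but the cut-off factor squeezes
        \<open>\<psi> j\<close> to 0 there.\<close>
      have "((\<lambda>w. real j * cmod (w + 1)) \<longlongrightarrow> real j * cmod (-1 + 1)) (at (-1) within sphere 0 1)"
        by (intro tendsto_intros)
      then have lim: "((\<lambda>w. real j * cmod (w + 1)) \<longlongrightarrow> 0) (at (-1) within sphere 0 1)" by simp
      have "eventually (\<lambda>w. cmod (\<psi> j w) \<le> real j * cmod (w + 1)) (at (-1) within sphere 0 1)"
        unfolding eventually_at_filter using \<psi>_le[of _ j] by (intro always_eventually) force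
      then have "(\<psi> j \<longlongrightarrow> 0) (at (-1) within sphere 0 1)"
        using lim by (rule Lim_null_comparison)
      then show ?thesis using True by (simp add: continuous_within \<psi>_def)
    next
      case False
      have "z \<notin> \<real>\<^sub>\<le>\<^sub>0"
      proof
        assume "z \<in> \<real>\<^sub>\<le>\<^sub>0"
        then obtain r where "r \<le> 0" "z = of_real r" by (auto elim: nonpos_Reals_cases)
        with z False show False by auto
      qed
      then show ?thesis unfolding \<psi>_def by (intro continuous_intros)
    qed
  qed
  have zero: "(LINT p|?M. K p * \<psi> j (\<gamma> p)) = 0" for j
    using \<gamma>_sphere \<psi>_cont
    by (intro integral_mult_continuous_eq_0[OF int_K \<gamma>_borel _ _ moments, of "sphere 0 1"]) auto
  \<comment> \<open>Only at these two points of the square is the difference of coordinates 2B or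
    -2B, that is, \<open>\<gamma>\<close> equal to -1.\<close>
  have "AE p in lborel. p \<noteq> (B, -B)" "AE p in lborel. p \<noteq> (-B, B)"
    by (rule AE_lborel_singleton)+
  then have corners: "AE p in ?M. p \<noteq> (B, -B) \<and> p \<noteq> (-B, B)"
    unfolding lborel_prod by simp
  have lim: "(\<lambda>j. K p * \<psi> j (\<gamma> p)) \<longlonglongrightarrow> K p * e x (fst p - snd p)"
    if p: "p \<noteq> (B, -B)" "p \<noteq> (-B, B)" for p
  proof (cases "K p = 0")
    case False
    \<comment> \<open>An argument of \<open>\<gamma> p\<close>; off the corners it lies strictly
      between -pi and pi, so the principal logarithm returns it.\<close>
    define \<theta> where "\<theta> = 2 * pi * (fst p - snd p) / (4 * B)"
    have "fst p \<in> {-B..B}" "snd p \<in> {-B..B}"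
      using False supp unfolding K_def by force+
    with p have "- (2 * B) < fst p - snd p" "fst p - snd p < 2 * B"
      by (cases p; force)+
    then have r: "- 1 < (fst p - snd p) / (2 * B)" "(fst p - snd p) / (2 * B) < 1"
      using B by (simp_all add: field_simps)
    have "pi * - 1 < pi * ((fst p - snd p) / (2 * B))" "pi * ((fst p - snd p) / (2 * B)) < pi * 1"
      by (rule mult_strict_left_mono[OF r(1) pi_gt_zero], rule mult_strict_left_mono[OF r(2) pi_gt_zero])
    moreover have "pi * ((fst p - snd p) / (2 * B)) = \<theta>" using B by (simp add: \<theta>_def field_simps)
    ultimately have \<theta>: "- pi < \<theta>" "\<theta> < pi" by simp_all
    have \<gamma>_eq: "\<gamma> p = exp (\<i> * of_real \<theta>)"
      unfolding \<gamma>_def e_def \<theta>_def by (rule arg_cong[where f = exp]) simp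
    have Ln: "Ln (\<gamma> p) = \<i> * of_real \<theta>" unfolding \<gamma>_eq using \<theta> by (intro Ln_exp) auto
    have "\<gamma> p \<noteq> -1"
    proof
      assume "\<gamma> p = -1"
      then have "Ln (\<gamma> p) = \<i> * pi" by simp
      with Ln \<theta> show False by simp
    qed
    then have pos: "cmod (\<gamma> p + 1) > 0" by (simp add: add_eq_0_iff2)
    have "eventually (\<lambda>j. real j > 1 / cmod (\<gamma> p + 1)) sequentially"
      using filterlim_real_sequentially by (simp add: filterlim_at_top_dense)
    then have "eventually (\<lambda>j. K p * \<psi> j (\<gamma> p) = K p * e x (fst p - snd p)) sequentially"
    proof eventually_elim
      case (elim j)
      then have "min 1 (real j * cmod (\<gamma> p + 1)) = 1" using pos by (simp add: field_simps min_def)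
      moreover have "exp (of_real (4 * B * x) * Ln (\<gamma> p)) = e x (fst p - snd p)"
        unfolding Ln e_def \<theta>_def using B by (intro arg_cong[where f = exp]) (simp add: field_simps)
      ultimately show ?case by (simp add: \<psi>_def)
    qed
    then show ?thesis by (rule tendsto_eventually)
  qed simp
  have "(\<lambda>j. LINT p|?M. K p * \<psi> j (\<gamma> p)) \<longlonglongrightarrow> (LINT p|?M. K p * e x (fst p - snd p))"
  proof (rule integral_dominated_convergence)
    show "integrable ?M (\<lambda>p. cmod (K p))" using int_K by auto
    show "AE p in ?M. (\<lambda>j. K p * \<psi> j (\<gamma> p)) \<longlonglongrightarrow> K p * e x (fst p - snd p)"
      using corners by eventually_elim (use lim in blast)
    have "cmod (\<psi> j (\<gamma> p)) \<le> 1" for j p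
      using \<psi>_le[of "\<gamma> p" j] \<gamma>_sphere[of p] by simp
    then show "AE p in ?M. cmod (K p * \<psi> j (\<gamma> p)) \<le> cmod (K p)" for j
      by (simp add: norm_mult mult_left_le)
  qed measurable
  then have "(LINT p|?M. K p * e x (fst p - snd p)) = 0" by (simp add: zero LIMSEQ_const_iff)
  then have "(cmod (fourier_laplace k (of_real x)))\<^sup>2 = (cmod (fourier_laplace m (of_real x)))\<^sup>2"
    unfolding int_Ke by (metis eq_iff_diff_eq_0 of_real_eq_iff)
  then show ?thesis by simp
qed

subsection \<open>The Gabor transform on the Fourier side\<close>

lemma L2_iff: "f \<in> L2 \<longleftrightarrow> f \<in> borel_measurable borel \<and> integrable lborel (\<lambda>t. (cmod (f t))\<^sup>2)"
  by (simp add: L2_def)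

lemma integrable_L2_mult:
  assumes "f \<in> L2" "g \<in> L2"
  shows "integrable lborel (\<lambda>t. f t * g t)"
proof (rule Bochner_Integration.integrable_bound)
  have [measurable]: "f \<in> borel_measurable borel" "g \<in> borel_measurable borel"
    using assms by (auto simp: L2_iff)
  show "(\<lambda>t. f t * g t) \<in> borel_measurable lborel" by measurable
  show "integrable lborel (\<lambda>t. (cmod (f t))\<^sup>2 + (cmod (g t))\<^sup>2)"
    using assms by (simp add: L2_iff)
  have "cmod (f t) * cmod (g t) \<le> (cmod (f t))\<^sup>2 + (cmod (g t))\<^sup>2" for t
    using sum_squares_bound[of "cmod (f t)" "cmod (g t)"]
      mult_nonneg_nonneg[OF norm_ge_zero norm_ge_zero, of "f t" "g t"] by linarith
  then show "AE t in lborel. norm (f t * g t) \<le> norm ((cmod (f t))\<^sup>2 + (cmod (g t))\<^sup>2)"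
    by (simp add: norm_mult)
qed

lemma cmod_integral_L2_mult_le:
  assumes f: "f \<in> L2" and g: "g \<in> L2"
  shows "cmod (LINT t|lborel. f t * g t)
    \<le> sqrt ((LINT t|lborel. (cmod (f t))\<^sup>2) * (LINT t|lborel. (cmod (g t))\<^sup>2))"
proof -
  have [measurable]: "f \<in> borel_measurable borel" "g \<in> borel_measurable borel"
    using f g by (auto simp: L2_iff)
  have int: "integrable lborel (\<lambda>t. cmod (f t) * cmod (g t))"
    using integrable_norm[OF integrable_L2_mult[OF f g]] by (simp add: norm_mult)
  have "cmod (LINT t|lborel. f t * g t) \<le> (LINT t|lborel. cmod (f t) * cmod (g t))"
    using integral_norm_bound[of lborel "\<lambda>t. f t * g t"] by (simp add: norm_mult)
  also have "\<dots> \<le> sqrt ((LINT t|lborel. (cmod (f t))\<^sup>2) * (LINT t|lborel. (cmod (g t))\<^sup>2))"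
  proof (rule real_le_rsqrt)
    have "ennreal ((LINT t|lborel. cmod (f t) * cmod (g t))\<^sup>2)
        = (\<integral>\<^sup>+ t. ennreal (cmod (f t)) * ennreal (cmod (g t)) \<partial>lborel)\<^sup>2"
      using nn_integral_eq_integral[OF int] by (simp add: ennreal_mult ennreal_power)
    also have "\<dots> \<le> (\<integral>\<^sup>+ t. (ennreal (cmod (f t)))\<^sup>2 \<partial>lborel) * (\<integral>\<^sup>+ t. (ennreal (cmod (g t)))\<^sup>2 \<partial>lborel)"
      by (rule Cauchy_Schwarz_nn_integral) measurable
    also have "\<dots> = ennreal ((LINT t|lborel. (cmod (f t))\<^sup>2) * (LINT t|lborel. (cmod (g t))\<^sup>2))"
      using f g by (simp add: L2_iff ennreal_power nn_integral_eq_integral ennreal_mult)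
    finally show "(LINT t|lborel. cmod (f t) * cmod (g t))\<^sup>2
        \<le> (LINT t|lborel. (cmod (f t))\<^sup>2) * (LINT t|lborel. (cmod (g t))\<^sup>2)"
      by (simp add: ennreal_le_iff)
  qed
  finally show ?thesis .
qed

text \<open>Cauchy-Schwarz for the difference. Each \<open>\<phi> n\<close> is merely measurable,
  because the lemma also serves for Fourier transforms of an approximating sequence, not known
  beforehand to be square integrable.\<close>

lemma tendsto_integral_mult_L2:
  assumes \<phi>: "\<And>n. \<phi> n \<in> borel_measurable borel" and f: "f \<in> L2" and g: "g \<in> L2"
    and lim: "tendsto_L2 \<phi> f"
  shows "(\<lambda>n. LINT t|lborel. \<phi> n t * g t) \<longlonglongrightarrow> (LINT t|lborel. f t * g t)"
proof -
  note [measurable] = \<phi>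
  have [measurable]: "f \<in> borel_measurable borel" using f by (simp add: L2_iff)
  define D where "D n = (\<integral>\<^sup>+ t. ennreal ((cmod (\<phi> n t - f t))\<^sup>2) \<partial>lborel)" for n
  have D: "D \<longlonglongrightarrow> 0" using lim by (simp add: tendsto_L2_def D_def[abs_def])
  then have "(\<lambda>n. enn2real (D n)) \<longlonglongrightarrow> 0"
    using tendsto_enn2real[of D 0 sequentially] by simp
  then have "(\<lambda>n. sqrt (enn2real (D n) * (LINT t|lborel. (cmod (g t))\<^sup>2))) \<longlonglongrightarrow> sqrt (0 * (LINT t|lborel. (cmod (g t))\<^sup>2))"
    by (rule tendsto_real_sqrt[OF tendsto_mult[OF _ tendsto_const]])
  then have bound_lim: "(\<lambda>n. sqrt (enn2real (D n) * (LINT t|lborel. (cmod (g t))\<^sup>2))) \<longlonglongrightarrow> 0" by simp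
  \<comment> \<open>Any finite bound would do: it puts the difference in \<open>L2\<close> and makes
    the extended integral an ordinary one.\<close>
  have "eventually (\<lambda>n. D n < 1) sequentially"
    using D by (rule order_tendstoD) simp
  then have "eventually (\<lambda>n. norm ((LINT t|lborel. \<phi> n t * g t) - (LINT t|lborel. f t * g t))
      \<le> sqrt (enn2real (D n) * (LINT t|lborel. (cmod (g t))\<^sup>2))) sequentially"
  proof eventually_elim
    case (elim n)
    then have "D n < \<infinity>" by (metis ennreal_one_less_top infinity_ennreal_def less_trans)
    then have int: "integrable lborel (\<lambda>t. (cmod (\<phi> n t - f t))\<^sup>2)"
      unfolding D_def by (intro integrableI_nonneg) auto
    then have d: "(\<lambda>t. \<phi> n t - f t) \<in> L2" by (simp add: L2_iff)
    have D_eq: "enn2real (D n) = (LINT t|lborel. (cmod (\<phi> n t - f t))\<^sup>2)"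
      using int by (simp add: D_def nn_integral_eq_integral)
    have "(LINT t|lborel. \<phi> n t * g t) = (LINT t|lborel. (\<phi> n t - f t) * g t + f t * g t)"
      by (simp add: algebra_simps)
    also have "\<dots> = (LINT t|lborel. (\<phi> n t - f t) * g t) + (LINT t|lborel. f t * g t)"
      using integrable_L2_mult[OF d g] integrable_L2_mult[OF f g] by (rule Bochner_Integration.integral_add)
    finally have "(LINT t|lborel. \<phi> n t * g t) - (LINT t|lborel. f t * g t) = (LINT t|lborel. (\<phi> n t - f t) * g t)"
      by simp
    then show ?case using cmod_integral_L2_mult_le[OF d g] unfolding D_eq by simp
  qed
  then have "(\<lambda>n. (LINT t|lborel. \<phi> n t * g t) - (LINT t|lborel. f t * g t)) \<longlonglongrightarrow> 0"
    using bound_lim by (rule Lim_null_comparison)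
  then show ?thesis by (simp add: LIM_zero_iff)
qed

section \<open>The multiplication formula for the Fourier transform\<close>

lemma borel_measurable_fourier_L1:
  assumes "f \<in> borel_measurable borel"
  shows "fourier_L1 f \<in> borel_measurable borel"
proof -
  note [measurable] = assms
  show ?thesis unfolding fourier_L1_def by measurable
qed

text \<open>Fubini, with a kernel symmetric in its two variables.\<close>

lemma integral_fourier_L1_mult:
  assumes f: "integrable lborel f" and g: "integrable lborel g"
  shows "(LINT t|lborel. f t * fourier_L1 g t) = (LINT t|lborel. fourier_L1 f t * g t)"
proof -
  define E where "E t \<xi> = exp (- 2 * complex_of_real pi * \<i> * of_real t * of_real \<xi>)" for t \<xi> :: real
  have E_commute: "E t \<xi> = E \<xi> t" for t \<xi> by (simp add: E_def mult_ac)
  have [measurable]: "(\<lambda>p. E (fst p) (snd p)) \<in> borel_measurable (lborel \<Otimes>\<^sub>M lborel)"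
    unfolding E_def by measurable
  have "integrable (lborel \<Otimes>\<^sub>M lborel) (\<lambda>p. f (fst p) * g (snd p) * E (fst p) (snd p))"
    using f g by (intro integrable_mult_bounded[of _ _ _ 1] integrable_lborel_times) (auto simp: E_def)
  then have int: "integrable (lborel \<Otimes>\<^sub>M lborel) (\<lambda>(t, \<xi>). f t * g \<xi> * E t \<xi>)"
    by (simp add: case_prod_beta')
  have "(LINT t|lborel. f t * fourier_L1 g t) = (LINT t|lborel. LINT \<xi>|lborel. f t * g \<xi> * E t \<xi>)"
    unfolding fourier_L1_def E_def[symmetric]
    by (subst integral_mult_right_zero[symmetric]) (simp add: mult_ac E_commute)
  also have "\<dots> = (LINT \<xi>|lborel. LINT t|lborel. f t * g \<xi> * E t \<xi>)"
    using lborel_pair.Fubini_integral[OF int] by simp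
  also have "\<dots> = (LINT \<xi>|lborel. fourier_L1 f \<xi> * g \<xi>)"
    unfolding fourier_L1_def E_def[symmetric]
    by (subst integral_mult_left_zero[symmetric]) (simp add: mult_ac)
  finally show ?thesis .
qed

text \<open>The multiplication formula passes to the limit along the approximating sequence. It
  gives access to \<open>h\<close> through pairings, in place of Plancherel's theorem.\<close>

lemma integral_fourier_L2_mult:
  assumes fh: "has_fourier_L2 f h" and g: "integrable lborel g" "g \<in> L2" "fourier_L1 g \<in> L2"
  shows "(LINT t|lborel. f t * fourier_L1 g t) = (LINT \<xi>|lborel. h \<xi> * g \<xi>)"
proof -
  obtain \<phi> where f: "f \<in> L2" and h: "h \<in> L2" and \<phi>: "\<And>n. \<phi> n \<in> L1" "\<And>n. \<phi> n \<in> L2"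
    and lim: "tendsto_L2 \<phi> f" "tendsto_L2 (\<lambda>n. fourier_L1 (\<phi> n)) h"
    using fh unfolding has_fourier_L2_def by auto
  have \<phi>_borel: "\<phi> n \<in> borel_measurable borel" for n using \<phi>(2) by (simp add: L2_iff)
  have "(\<lambda>n. LINT t|lborel. \<phi> n t * fourier_L1 g t) \<longlonglongrightarrow> (LINT t|lborel. f t * fourier_L1 g t)"
    using \<phi>_borel f g(3) lim(1) by (rule tendsto_integral_mult_L2)
  moreover have "(LINT t|lborel. \<phi> n t * fourier_L1 g t) = (LINT t|lborel. fourier_L1 (\<phi> n) t * g t)" for n
    using \<phi>(1)[of n] g(1) by (intro integral_fourier_L1_mult) (auto simp: L1_def)
  moreover have "(\<lambda>n. LINT t|lborel. fourier_L1 (\<phi> n) t * g t) \<longlonglongrightarrow> (LINT t|lborel. h t * g t)"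
    using borel_measurable_fourier_L1[OF \<phi>_borel] h g(2) lim(2) by (rule tendsto_integral_mult_L2)
  ultimately show ?thesis using LIMSEQ_unique by auto
qed

section \<open>Gaussians and their Fourier transforms\<close>

lemma fourier_L1_gaussian: "fourier_L1 (\<lambda>u. of_real (exp (- pi * u\<^sup>2))) s = of_real (exp (- pi * s\<^sup>2))"
proof -
  \<comment> \<open>The substitution x = r u turns the standard normal density into
    \<open>exp (- pi * u\<^sup>2)\<close>, its normalising constant 1 / r cancelling the
    Jacobian.\<close>
  define r where "r = sqrt (2 * pi)"
  have r: "r > 0" "r\<^sup>2 = 2 * pi" by (simp_all add: r_def)
  have "complex_of_real (exp (- pi * s\<^sup>2)) = char std_normal_distribution (- r * s)"
    using r by (simp add: char_std_normal_distribution power_mult_distrib)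
  also have "\<dots> = (LINT x|lborel. std_normal_density x *\<^sub>R iexp (- r * s * x))"
    unfolding char_def by (subst integral_density) (auto simp: normal_density_nonneg)
  also have "\<dots> = r *\<^sub>R (LINT u|lborel. std_normal_density (0 + r * u) *\<^sub>R iexp (- r * s * (0 + r * u)))"
    using r by (subst lborel_integral_real_affine[where c = r and t = 0]) auto
  also have "\<dots> = (LINT u|lborel. r *\<^sub>R (std_normal_density (0 + r * u) *\<^sub>R iexp (- r * s * (0 + r * u))))"
    by (rule integral_scaleR_right[symmetric])
  also have "\<dots> = fourier_L1 (\<lambda>u. of_real (exp (- pi * u\<^sup>2))) s"
    unfolding fourier_L1_def
  proof (rule Bochner_Integration.integral_cong[OF refl])
    fix u :: real
    have density: "r * std_normal_density (0 + r * u) = exp (- pi * u\<^sup>2)"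
      using r unfolding std_normal_density_def r_def[symmetric] by (simp add: power_mult_distrib)
    have "- r * s * (0 + r * u) = - 2 * pi * u * s"
      using r(2) by (simp add: power2_eq_square)
    then have "iexp (- r * s * (0 + r * u)) = exp (- 2 * complex_of_real pi * \<i> * of_real u * of_real s)"
      by (simp only:) (rule arg_cong[where f = exp], simp)
    then show "r *\<^sub>R (std_normal_density (0 + r * u) *\<^sub>R iexp (- r * s * (0 + r * u))) =
      of_real (exp (- pi * u\<^sup>2)) * exp (- 2 * complex_of_real pi * \<i> * of_real u * of_real s)"
      by (simp only: scaleR_scaleR density) (simp only: scaleR_conv_of_real)
  qed
  finally show ?thesis by simp
qed

text \<open>The function whose Fourier transform is the Gabor kernel at
  \<open>(x, \<omega>)\<close>.\<close>

definition gauss_atom :: "real \<Rightarrow> real \<Rightarrow> real \<Rightarrow> complex" where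
  "gauss_atom x \<omega> \<xi> = of_real (exp (- pi * (\<xi> - \<omega>)\<^sup>2)) * exp (2 * complex_of_real pi * \<i> * of_real x * of_real (\<xi> - \<omega>))"

lemma cmod_gauss_atom: "cmod (gauss_atom x \<omega> \<xi>) = exp (- pi * (\<xi> - \<omega>)\<^sup>2)"
  by (simp add: gauss_atom_def norm_mult)

lemma borel_measurable_gauss_atom[measurable]: "gauss_atom x \<omega> \<in> borel_measurable borel"
  unfolding gauss_atom_def by measurable

lemma integrable_gaussian: "integrable lborel (\<lambda>\<xi>. exp (- pi * (\<xi> - \<omega>)\<^sup>2))"
proof -
  have "exp (- pi * (\<xi> - \<omega>)\<^sup>2) = normal_density \<omega> (1 / sqrt (2 * pi)) \<xi>" for \<xi>
    by (simp add: normal_density_def power_divide)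
  then show ?thesis using integrable_normal_density[of "1 / sqrt (2 * pi)" \<omega>] by simp
qed

lemma integrable_gauss_atom: "integrable lborel (gauss_atom x \<omega>)"
  by (rule Bochner_Integration.integrable_bound[OF integrable_gaussian[of \<omega>]]) (auto simp: cmod_gauss_atom)

lemma L2_if_gaussian_bound:
  assumes "f \<in> borel_measurable borel" "\<And>\<xi>. cmod (f \<xi>) = exp (- pi * (\<xi> - \<omega>)\<^sup>2)"
  shows "f \<in> L2"
  unfolding L2_iff
proof
  show "integrable lborel (\<lambda>t. (cmod (f t))\<^sup>2)"
  proof (rule Bochner_Integration.integrable_bound[OF integrable_gaussian[of \<omega>]])
    have "(exp (- pi * (\<xi> - \<omega>)\<^sup>2))\<^sup>2 \<le> exp (- pi * (\<xi> - \<omega>)\<^sup>2)" for \<xi>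
      by (simp add: power2_eq_square[of "exp _"] mult_le_cancel_left1 mult_left_le)
    then show "AE \<xi> in lborel. norm ((cmod (f \<xi>))\<^sup>2) \<le> norm (exp (- pi * (\<xi> - \<omega>)\<^sup>2))"
      by (simp add: assms(2))
  qed (use assms(1) in simp)
qed (use assms in simp)

text \<open>Shifting the variable by \<open>\<omega>\<close> leaves the transform of the centred
  Gaussian at \<open>t - x\<close>, times a phase.\<close>

lemma fourier_L1_gauss_atom:
  "fourier_L1 (gauss_atom x \<omega>) t =
    of_real (exp (- pi * (t - x)\<^sup>2)) * exp (- 2 * complex_of_real pi * \<i> * of_real t * of_real \<omega>)"
proof -
  have "fourier_L1 (gauss_atom x \<omega>) t = (LINT u|lborel. gauss_atom x \<omega> (\<omega> + u)
      * exp (- 2 * complex_of_real pi * \<i> * of_real (\<omega> + u) * of_real t))"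
    unfolding fourier_L1_def by (subst lborel_integral_real_affine[where c = 1 and t = \<omega>]) auto
  also have "\<dots> = (LINT u|lborel. (of_real (exp (- pi * u\<^sup>2))
      * exp (- 2 * complex_of_real pi * \<i> * of_real u * of_real (t - x)))
      * exp (- 2 * complex_of_real pi * \<i> * of_real t * of_real \<omega>))"
  proof (rule Bochner_Integration.integral_cong[OF refl])
    fix u :: real
    have "exp (2 * complex_of_real pi * \<i> * of_real x * of_real u)
        * exp (- 2 * complex_of_real pi * \<i> * of_real (\<omega> + u) * of_real t)
      = exp (- 2 * complex_of_real pi * \<i> * of_real u * of_real (t - x))
        * exp (- 2 * complex_of_real pi * \<i> * of_real t * of_real \<omega>)"
      unfolding exp_add[symmetric] by (rule arg_cong[where f = exp]) (simp add: algebra_simps)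
    then show "gauss_atom x \<omega> (\<omega> + u) * exp (- 2 * complex_of_real pi * \<i> * of_real (\<omega> + u) * of_real t) =
      of_real (exp (- pi * u\<^sup>2)) * exp (- 2 * complex_of_real pi * \<i> * of_real u * of_real (t - x))
      * exp (- 2 * complex_of_real pi * \<i> * of_real t * of_real \<omega>)"
      by (simp add: gauss_atom_def mult.assoc)
  qed
  also have "\<dots> = fourier_L1 (\<lambda>u. of_real (exp (- pi * u\<^sup>2))) (t - x)
      * exp (- 2 * complex_of_real pi * \<i> * of_real t * of_real \<omega>)"
    unfolding fourier_L1_def by (rule integral_mult_left_zero)
  finally show ?thesis unfolding fourier_L1_gaussian .
qed

text \<open>The multiplication formula moves the integral to the Fourier side, the kernel being the
  transform of \<open>gauss_atom\<close>.\<close>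

lemma gabor_eq_integral_fourier:
  assumes "has_fourier_L2 f h"
  shows "gabor f x \<omega> = complex_of_real (root 4 2) * (LINT \<xi>|lborel. h \<xi> * gauss_atom x \<omega> \<xi>)"
proof -
  have "fourier_L1 (gauss_atom x \<omega>) \<in> L2"
    by (rule L2_if_gaussian_bound[of _ x])
      (auto simp: fourier_L1_gauss_atom norm_mult intro: borel_measurable_fourier_L1)
  moreover have "gauss_atom x \<omega> \<in> L2"
    by (rule L2_if_gaussian_bound[of _ \<omega>]) (auto simp: cmod_gauss_atom)
  ultimately have "(LINT t|lborel. f t * fourier_L1 (gauss_atom x \<omega>) t) = (LINT \<xi>|lborel. h \<xi> * gauss_atom x \<omega> \<xi>)"
    using assms integrable_gauss_atom by (intro integral_fourier_L2_mult)
  then show ?thesis by (simp only: gabor_def fourier_L1_gauss_atom mult.assoc)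
qed

text \<open>The indicator turns a support condition valid almost everywhere into the pointwise one
  assumed in the results on \<open>fourier_laplace\<close>.\<close>

definition gauss_window :: "real \<Rightarrow> (real \<Rightarrow> complex) \<Rightarrow> real \<Rightarrow> complex" where
  "gauss_window B h \<xi> = indicator {-B..B} \<xi> * h \<xi> * of_real (exp (- pi * \<xi>\<^sup>2))"

lemma gauss_window_supp: "gauss_window B h \<xi> \<noteq> 0 \<Longrightarrow> \<xi> \<in> {-B..B}"
  by (auto simp: gauss_window_def indicator_def split: if_splits)

lemma integrable_gauss_window:
  assumes "h \<in> L2"
  shows "integrable lborel (gauss_window B h)"
proof -
  have [measurable]: "h \<in> borel_measurable borel" using assms by (simp add: L2_iff)
  have "(\<lambda>\<xi>. of_real (exp (- pi * (\<xi> - 0)\<^sup>2))) \<in> L2"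
    by (rule L2_if_gaussian_bound[of _ 0]) auto
  then have "integrable lborel (\<lambda>\<xi>. h \<xi> * of_real (exp (- pi * (\<xi> - 0)\<^sup>2)))"
    using assms by (intro integrable_L2_mult)
  then have "integrable lborel (\<lambda>\<xi>. h \<xi> * of_real (exp (- pi * (\<xi> - 0)\<^sup>2)) * indicator {-B..B} \<xi>)"
    by (rule integrable_mult_bounded[of _ _ _ 1]) (auto split: split_indicator)
  then show ?thesis by (simp add: gauss_window_def[abs_def] mult_ac)
qed

text \<open>On expanding the square in the Gaussian, the cross term joins the phase to form the
  complex argument x - i \<open>\<omega>\<close>. The terms free of \<open>\<xi>\<close> are
  collected in \<open>c\<close>.\<close>

lemma cmod_gabor_eq_fourier_laplace:
  assumes fh: "has_fourier_L2 f h" and supp: "supp_within h {-B..B}"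
  shows "cmod (gabor f x \<omega>)
    = root 4 2 * exp (- pi * \<omega>\<^sup>2) * cmod (fourier_laplace (gauss_window B h) (Complex x (- \<omega>)))"
proof -
  have h: "h \<in> L2" using fh by (simp add: has_fourier_L2_def)
  have [measurable]: "h \<in> borel_measurable borel" using h by (simp add: L2_iff)
  note [measurable] = borel_measurable_integrable[OF integrable_gauss_window[OF h, of B]]
  define c where "c = exp (- of_real pi * (of_real \<omega>)\<^sup>2 - 2 * complex_of_real pi * \<i> * of_real x * of_real \<omega>)"
  have atom: "gauss_atom x \<omega> \<xi> = c * (of_real (exp (- pi * \<xi>\<^sup>2))
      * exp (2 * complex_of_real pi * \<i> * Complex x (- \<omega>) * of_real \<xi>))" for \<xi>
  proof -
    have z: "Complex x (- \<omega>) = of_real x - \<i> * of_real \<omega>" by (simp add: complex_eq_iff)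
    show ?thesis
      unfolding gauss_atom_def c_def z exp_of_real[symmetric] exp_add[symmetric]
      by (rule arg_cong[where f = exp]) (simp add: algebra_simps power2_eq_square)
  qed
  have "(LINT \<xi>|lborel. h \<xi> * gauss_atom x \<omega> \<xi>)
      = (LINT \<xi>|lborel. c * (gauss_window B h \<xi> * exp (2 * complex_of_real pi * \<i> * Complex x (- \<omega>) * of_real \<xi>)))"
  proof (rule integral_cong_AE)
    show "AE \<xi> in lborel. h \<xi> * gauss_atom x \<omega> \<xi>
      = c * (gauss_window B h \<xi> * exp (2 * complex_of_real pi * \<i> * Complex x (- \<omega>) * of_real \<xi>))"
      using supp unfolding supp_within_def
      by eventually_elim (auto simp: atom gauss_window_def split: split_indicator)
  qed measurable
  also have "\<dots> = c * fourier_laplace (gauss_window B h) (Complex x (- \<omega>))"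
    unfolding fourier_laplace_def by (rule integral_mult_right_zero)
  finally have "gabor f x \<omega> = complex_of_real (root 4 2) * (c * fourier_laplace (gauss_window B h) (Complex x (- \<omega>)))"
    unfolding gabor_eq_integral_fourier[OF fh] by simp
  moreover have "cmod c = exp (- pi * \<omega>\<^sup>2)" by (simp add: c_def power2_eq_square)
  ultimately show ?thesis by (simp add: norm_mult)
qed

text \<open>The height \<open>y\<close> becomes a real exponential weight, which reduces a
  horizontal line to the real axis.\<close>

lemma fourier_laplace_Complex:
  "fourier_laplace k (Complex x y) = fourier_laplace (\<lambda>\<xi>. k \<xi> * of_real (exp (- 2 * pi * y * \<xi>))) (of_real x)"
proof -
  have z: "Complex x y = of_real x + \<i> * of_real y" by (simp add: complex_eq_iff)
  have "exp (2 * complex_of_real pi * \<i> * Complex x y * of_real \<xi>)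
      = of_real (exp (- 2 * pi * y * \<xi>)) * exp (2 * complex_of_real pi * \<i> * of_real x * of_real \<xi>)" for \<xi>
    unfolding z exp_of_real[symmetric] exp_add[symmetric]
    by (rule arg_cong[where f = exp]) (simp add: algebra_simps)
  then show ?thesis by (simp only: fourier_laplace_def mult.assoc)
qed

lemma cmod_fourier_laplace_eq_on_line:
  fixes B x y :: real and k m :: "real \<Rightarrow> complex"
  assumes B: "B > 0" and k: "integrable lborel k" and m: "integrable lborel m"
    and supp: "\<And>\<xi>. k \<xi> \<noteq> 0 \<or> m \<xi> \<noteq> 0 \<Longrightarrow> \<xi> \<in> {-B..B}"
    and grid: "\<And>j::int. cmod (fourier_laplace k (Complex (1 / (4 * B) * of_int j) y))
                 = cmod (fourier_laplace m (Complex (1 / (4 * B) * of_int j) y))"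
  shows "cmod (fourier_laplace k (Complex x y)) = cmod (fourier_laplace m (Complex x y))"
proof -
  have int: "integrable lborel (\<lambda>\<xi>. h \<xi> * of_real (exp (- 2 * pi * y * \<xi>)))"
    if h: "integrable lborel h" "\<And>\<xi>. h \<xi> \<noteq> 0 \<Longrightarrow> \<xi> \<in> {-B..B}" for h :: "real \<Rightarrow> complex"
  proof (rule integrable_mult_bounded[OF h(1)])
    fix \<xi> assume "h \<xi> \<noteq> 0"
    then have "\<bar>\<xi>\<bar> \<le> B" using h(2)[of \<xi>] by auto
    then have "\<bar>- 2 * pi * y * \<xi>\<bar> \<le> 2 * pi * \<bar>y\<bar> * B" by (simp add: abs_mult mult_left_mono)
    then show "cmod (of_real (exp (- 2 * pi * y * \<xi>))) \<le> exp (2 * pi * \<bar>y\<bar> * B)"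
      unfolding norm_of_real abs_exp_cancel exp_le_cancel_iff by linarith
  qed measurable
  show ?thesis
    unfolding fourier_laplace_Complex
  proof (rule cmod_fourier_laplace_eq_if_eq_on_grid[OF B int[OF k] int[OF m]])
    show "\<xi> \<in> {-B..B}" if "k \<xi> \<noteq> 0" for \<xi> using that supp by blast
    show "\<xi> \<in> {-B..B}" if "m \<xi> \<noteq> 0" for \<xi> using that supp by blast
    show "\<xi> \<in> {-B..B}" if "k \<xi> * of_real (exp (- 2 * pi * y * \<xi>)) \<noteq> 0
        \<or> m \<xi> * of_real (exp (- 2 * pi * y * \<xi>)) \<noteq> 0" for \<xi>
      using that supp[of \<xi>] by fastforce
  qed (rule grid[unfolded fourier_laplace_Complex])
qed

text \<open>Each step of height \<open>s\<close> multiplies the integrand by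
  \<open>exp (- 2 * pi * s * \<xi>)\<close>, so the n-th equality is the vanishing of the n-th
  exponential moment of \<open>(k \<xi> - m \<xi>) * e \<xi>\<close>, where \<open>e\<close> has no
  zeros.\<close>

lemma AE_eq_if_fourier_laplace_eq:
  fixes B c x a s :: real and k m :: "real \<Rightarrow> complex"
  assumes k: "integrable lborel k" and m: "integrable lborel m"
    and supp: "\<And>\<xi>. k \<xi> \<noteq> 0 \<or> m \<xi> \<noteq> 0 \<Longrightarrow> \<xi> \<in> {-B..B}" and s: "s \<noteq> 0"
    and eq: "\<And>n::nat. fourier_laplace k (Complex x (a + real n * s)) = fourier_laplace m (Complex x (a + real n * s))"
  shows "AE \<xi> in lborel. k \<xi> = m \<xi>"
proof -
  define e where "e \<xi> = exp (2 * complex_of_real pi * \<i> * Complex x a * of_real \<xi>)" for \<xi> :: real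
  have e_borel[measurable]: "e \<in> borel_measurable borel" unfolding e_def by measurable
  have e_bound: "cmod (exp (2 * complex_of_real pi * \<i> * Complex x y * of_real \<xi>)) \<le> exp (2 * pi * \<bar>y\<bar> * \<bar>B\<bar>)"
    if "\<xi> \<in> {-B..B}" for \<xi> y
  proof -
    have "\<bar>\<xi>\<bar> \<le> \<bar>B\<bar>" using that by auto
    then have "\<bar>- 2 * pi * y * \<xi>\<bar> \<le> 2 * pi * \<bar>y\<bar> * \<bar>B\<bar>" by (simp add: abs_mult mult_left_mono)
    then have "- 2 * pi * y * \<xi> \<le> 2 * pi * \<bar>y\<bar> * \<bar>B\<bar>" by linarith
    then show ?thesis by simp
  qed
  have int: "integrable lborel (\<lambda>\<xi>. h \<xi> * exp (2 * complex_of_real pi * \<i> * Complex x y * of_real \<xi>))"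
    if "integrable lborel h" "\<And>\<xi>. h \<xi> \<noteq> 0 \<Longrightarrow> \<xi> \<in> {-B..B}" for h :: "real \<Rightarrow> complex" and y
    using that(2) by (intro integrable_mult_bounded[OF that(1) _ e_bound]) auto
  have "AE \<xi> in lborel. (k \<xi> - m \<xi>) * e \<xi> = 0"
  proof (rule AE_eq_0_if_exponential_moments_eq_0)
    show "integrable lborel (\<lambda>\<xi>. (k \<xi> - m \<xi>) * e \<xi>)"
      unfolding e_def left_diff_distrib using k m supp
      by (intro Bochner_Integration.integrable_diff int) auto
    show "(k \<xi> - m \<xi>) * e \<xi> \<noteq> 0 \<Longrightarrow> \<xi> \<in> {-B..B}" for \<xi> by (rule supp) auto
    show "- 2 * pi * s \<noteq> 0" using s by simp
    show "(LINT \<xi>|lborel. (k \<xi> - m \<xi>) * e \<xi> * of_real (exp (- 2 * pi * s * \<xi>)) ^ n) = 0" for n :: nat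
    proof -
      define y where "y = a + real n * s"
      have z: "Complex x a = of_real x + \<i> * of_real a" "Complex x y = of_real x + \<i> * of_real y"
        by (simp_all add: complex_eq_iff)
      have "e \<xi> * of_real (exp (- 2 * pi * s * \<xi>)) ^ n = exp (2 * complex_of_real pi * \<i> * Complex x y * of_real \<xi>)" for \<xi>
        unfolding e_def z exp_of_real[symmetric] exp_of_nat_mult[symmetric] exp_add[symmetric]
        by (rule arg_cong[where f = exp]) (simp add: y_def algebra_simps)
      then have "(LINT \<xi>|lborel. (k \<xi> - m \<xi>) * e \<xi> * of_real (exp (- 2 * pi * s * \<xi>)) ^ n)
         = (LINT \<xi>|lborel. k \<xi> * exp (2 * complex_of_real pi * \<i> * Complex x y * of_real \<xi>)
             - m \<xi> * exp (2 * complex_of_real pi * \<i> * Complex x y * of_real \<xi>))"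
        by (simp only: mult.assoc left_diff_distrib)
      also have "\<dots> = fourier_laplace k (Complex x y) - fourier_laplace m (Complex x y)"
        unfolding fourier_laplace_def using k m supp
        by (intro Bochner_Integration.integral_diff int) auto
      finally show ?thesis using eq[of n] by (simp add: y_def)
    qed
  qed auto
  then show ?thesis by eventually_elim (simp add: e_def)
qed

text \<open>For fixed \<open>x\<close> the Gabor transform is, up to a constant, the Fourier
  transform of the function times a zero-free Gaussian. Injectivity on L1 recovers the function
  without an inversion formula on \<open>L2\<close>.\<close>

lemma AE_eq_if_gabor_eq:
  assumes f: "f \<in> L2" and g: "g \<in> L2" and eq: "\<And>\<omega>. gabor f x \<omega> = c * gabor g x \<omega>"
  shows "AE t in lborel. f t = c * g t"
proof -
  define F where "F h t = h t * of_real (exp (- pi * (t - x)\<^sup>2))" for h :: "real \<Rightarrow> complex" and t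
  have "(\<lambda>t. of_real (exp (- pi * (t - x)\<^sup>2))) \<in> L2"
    by (rule L2_if_gaussian_bound[of _ x]) auto
  then have int: "integrable lborel (F h)" if "h \<in> L2" for h
    unfolding F_def using that by (intro integrable_L2_mult)
  have int_e: "integrable lborel (\<lambda>t. F h t * exp (- 2 * complex_of_real pi * \<i> * of_real t * of_real \<xi>))"
    if "h \<in> L2" for h \<xi>
    using int[OF that] by (rule integrable_mult_bounded[of _ _ _ 1]) auto
  have gabor: "gabor h x \<xi> = complex_of_real (root 4 2) * fourier_L1 (F h) \<xi>" for h \<xi>
    by (simp add: gabor_def fourier_L1_def F_def)
  have "fourier_L1 (\<lambda>t. F f t - c * F g t) \<xi> = fourier_L1 (F f) \<xi> - c * fourier_L1 (F g) \<xi>" for \<xi>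
  proof -
    have "fourier_L1 (\<lambda>t. F f t - c * F g t) \<xi>
      = (LINT t|lborel. F f t * exp (- 2 * complex_of_real pi * \<i> * of_real t * of_real \<xi>)
         - c * (F g t * exp (- 2 * complex_of_real pi * \<i> * of_real t * of_real \<xi>)))"
      unfolding fourier_L1_def by (simp only: left_diff_distrib mult.assoc)
    also have "\<dots> = fourier_L1 (F f) \<xi> - c * fourier_L1 (F g) \<xi>"
      unfolding fourier_L1_def using int_e[OF f] int_e[OF g] by simp
    finally show ?thesis .
  qed
  moreover have "fourier_L1 (F f) \<xi> = c * fourier_L1 (F g) \<xi>" for \<xi>
    using eq[of \<xi>] by (simp add: gabor)
  ultimately have "AE t in lborel. F f t - c * F g t = 0"
    using int[OF f] int[OF g] by (intro AE_eq_0_if_fourier_L1_eq_0) auto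
  then show ?thesis by eventually_elim (simp add: F_def)
qed

lemma gabor_cong_AE:
  assumes f: "f \<in> L2" and g: "g \<in> L2" and eq: "AE t in lborel. f t = c * g t"
  shows "gabor f x \<omega> = c * gabor g x \<omega>"
proof -
  have [measurable]: "f \<in> borel_measurable borel" "g \<in> borel_measurable borel"
    using f g by (auto simp: L2_iff)
  have "(LINT t|lborel. f t * of_real (exp (- pi * (t - x)\<^sup>2)) * exp (- 2 * complex_of_real pi * \<i> * of_real t * of_real \<omega>))
    = (LINT t|lborel. c * (g t * of_real (exp (- pi * (t - x)\<^sup>2)) * exp (- 2 * complex_of_real pi * \<i> * of_real t * of_real \<omega>)))"
    using eq by (intro integral_cong_AE) (auto simp: mult.assoc)
  also have "\<dots> = c * (LINT t|lborel. g t * of_real (exp (- pi * (t - x)\<^sup>2)) * exp (- 2 * complex_of_real pi * \<i> * of_real t * of_real \<omega>))"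
    by (rule integral_mult_right_zero)
  finally show ?thesis by (simp add: gabor_def)
qed

section \<open>Recovery up to phase from the moduli on the grid\<close>

lemma PW2_imp_L2: "f \<in> PW2 B \<Longrightarrow> f \<in> L2"
  by (simp add: PW2_def)

theorem theorem5:
  fixes B \<omega>\<^sub>0 \<omega>\<^sub>1 :: real and f g :: "real \<Rightarrow> complex"
  assumes "B > 0" and "\<omega>\<^sub>0 < \<omega>\<^sub>1" and "f \<in> PW2 B" and "g \<in> PW2 B"
  shows "global_phase_eq f g \<longleftrightarrow>
    (\<forall>(x, \<omega>) \<in> range (\<lambda>k::int. 1 / (4 * B) * of_int k) \<times> {\<omega>\<^sub>0, \<omega>\<^sub>1}.
       cmod (gabor f x \<omega>) = cmod (gabor g x \<omega>))"
proof
  assume "global_phase_eq f g"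
  then obtain \<alpha> :: real where "AE t in lborel. f t = exp (\<i> * of_real \<alpha>) * g t"
    by (auto simp: global_phase_eq_def)
  then have "gabor f x \<omega> = exp (\<i> * of_real \<alpha>) * gabor g x \<omega>" for x \<omega>
    by (rule gabor_cong_AE[OF assms(3,4)[THEN PW2_imp_L2]])
  then show "\<forall>(x, \<omega>) \<in> range (\<lambda>k::int. 1 / (4 * B) * of_int k) \<times> {\<omega>\<^sub>0, \<omega>\<^sub>1}.
     cmod (gabor f x \<omega>) = cmod (gabor g x \<omega>)"
    by (simp add: norm_mult)
next
  assume grid: "\<forall>(x, \<omega>) \<in> range (\<lambda>k::int. 1 / (4 * B) * of_int k) \<times> {\<omega>\<^sub>0, \<omega>\<^sub>1}.
     cmod (gabor f x \<omega>) = cmod (gabor g x \<omega>)"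
  obtain u v where u: "has_fourier_L2 f u" "supp_within u {-B..B}"
    and v: "has_fourier_L2 g v" "supp_within v {-B..B}"
    using assms(3,4) by (auto simp: PW2_def)
  have uv: "u \<in> L2" "v \<in> L2" using u(1) v(1) by (auto simp: has_fourier_L2_def)
  define k where "k = gauss_window B u"
  define m where "m = gauss_window B v"
  have k: "integrable lborel k" and m: "integrable lborel m"
    unfolding k_def m_def using uv by (auto intro: integrable_gauss_window)
  have supp: "\<xi> \<in> {-B..B}" if "k \<xi> \<noteq> 0 \<or> m \<xi> \<noteq> 0" for \<xi>
    using that gauss_window_supp unfolding k_def m_def by blast
  \<comment> \<open>Frequency \<open>\<omega>\<close> sits at height \<open>- \<omega>\<close>; the
    prefactor of the modulus is the same for \<open>f\<close> and \<open>g\<close> and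
    cancels.\<close>
  have line: "cmod (fourier_laplace k (Complex x (- \<omega>))) = cmod (fourier_laplace m (Complex x (- \<omega>)))"
    if "\<omega> \<in> {\<omega>\<^sub>0, \<omega>\<^sub>1}" for x \<omega>
  proof (rule cmod_fourier_laplace_eq_on_line[OF assms(1) k m supp])
    fix j :: int
    have "cmod (gabor f (1 / (4 * B) * of_int j) \<omega>) = cmod (gabor g (1 / (4 * B) * of_int j) \<omega>)"
      using grid that by blast
    then show "cmod (fourier_laplace k (Complex (1 / (4 * B) * of_int j) (- \<omega>)))
             = cmod (fourier_laplace m (Complex (1 / (4 * B) * of_int j) (- \<omega>)))"
      unfolding cmod_gabor_eq_fourier_laplace[OF u] cmod_gabor_eq_fourier_laplace[OF v] k_def m_def
      by simp
  qed
  have "fourier_laplace k holomorphic_on UNIV" "fourier_laplace m holomorphic_on UNIV"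
    using supp by (auto intro!: fourier_laplace_holomorphic[OF k, of B] fourier_laplace_holomorphic[OF m, of B])
  then obtain c x where c: "cmod c = 1"
    and ratio: "\<And>n::nat. fourier_laplace k (Complex x (- \<omega>\<^sub>0 + real n * (2 * (- \<omega>\<^sub>1 - - \<omega>\<^sub>0))))
         = c * fourier_laplace m (Complex x (- \<omega>\<^sub>0 + real n * (2 * (- \<omega>\<^sub>1 - - \<omega>\<^sub>0))))"
    using unimodular_ratio_on_two_lines[of "fourier_laplace k" "fourier_laplace m" "- \<omega>\<^sub>0" "- \<omega>\<^sub>1"] line
    by blast
  have "AE \<xi> in lborel. k \<xi> = c * m \<xi>"
  proof (rule AE_eq_if_fourier_laplace_eq[OF k, of _ B])
    show "2 * (- \<omega>\<^sub>1 - - \<omega>\<^sub>0) \<noteq> 0" using assms(2) by simp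
    show "fourier_laplace k (Complex x (- \<omega>\<^sub>0 + real n * (2 * (- \<omega>\<^sub>1 - - \<omega>\<^sub>0))))
        = fourier_laplace (\<lambda>\<xi>. c * m \<xi>) (Complex x (- \<omega>\<^sub>0 + real n * (2 * (- \<omega>\<^sub>1 - - \<omega>\<^sub>0))))" for n
      unfolding ratio by (simp add: fourier_laplace_def mult.assoc)
  qed (use m supp in auto)
  \<comment> \<open>Outside [-B, B] both transforms vanish almost everywhere; inside, the Gaussian
    factor is nonzero and cancels.\<close>
  with u(2) v(2) have AE_uv: "AE \<xi> in lborel. u \<xi> = c * v \<xi>"
    unfolding supp_within_def
  proof eventually_elim
    case (elim \<xi>)
    show ?case
    proof (cases "\<xi> \<in> {-B..B}")
      case True
      then show ?thesis using elim(3) by (simp add: k_def m_def gauss_window_def)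
    next
      case False
      then show ?thesis using elim(1,2) by simp
    qed
  qed
  have uv_eq: "(LINT \<xi>|lborel. u \<xi> * gauss_atom x \<omega> \<xi>) = c * (LINT \<xi>|lborel. v \<xi> * gauss_atom x \<omega> \<xi>)" for x \<omega>
  proof -
    have [measurable]: "u \<in> borel_measurable borel" "v \<in> borel_measurable borel"
      using uv by (auto simp: L2_iff)
    have "(LINT \<xi>|lborel. u \<xi> * gauss_atom x \<omega> \<xi>) = (LINT \<xi>|lborel. c * (v \<xi> * gauss_atom x \<omega> \<xi>))"
      using AE_uv by (intro integral_cong_AE) (auto simp: mult.assoc)
    then show ?thesis by simp
  qed
  \<comment> \<open>The slice x = 0, taken over all frequencies, already determines the
    function.\<close>
  have "gabor f 0 \<omega> = c * gabor g 0 \<omega>" for \<omega>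
    unfolding gabor_eq_integral_fourier[OF u(1)] gabor_eq_integral_fourier[OF v(1)] uv_eq by simp
  then have AE_fg: "AE t in lborel. f t = c * g t" by (rule AE_eq_if_gabor_eq[OF assms(3,4)[THEN PW2_imp_L2]])
  define \<alpha> where "\<alpha> = Arg c"
  have "c \<noteq> 0" using c by auto
  then have "c = exp (\<i> * of_real \<alpha>)"
    using Arg_eq[of c] unfolding c \<alpha>_def by simp
  with AE_fg show "global_phase_eq f g" unfolding global_phase_eq_def by blast
qed

end
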